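(* Let $M=G/H$ be a homogeneous space and let $F=\alpha\,\phi\!\left(x,\frac{\beta}{\alpha}\right)$ be a general $(\alpha,\beta)$-metric on $M$ which is defined by a $G$-invariant vector field $X$ and a $G$-invariant Riemannian metric $g$ on $M$. Then $F$ is a $G$-invariant general $(\alpha,\beta)$-metric if and only if $F$ is a $G$-invariant $(\alpha,\beta)$-metric. In particular, any left-invariant general $(\alpha,\beta)$-metric on a Lie group defined by a left-invariant vector field and a left-invariant Riemannian metric is a left-invariant $(\alpha,\beta)$-metric.
   Context: A Finsler metric $F$ on $M$ is a general $(\alpha,\beta)$-metric if $F(x,y)=\alpha\phi(x,\beta/\alpha)$ for some $C^\infty$ function $\phi=\phi(x,s)$ ($x\in M$), some Riemannian metric $g$ with $\alpha(x,y)=\sqrt{g_x(y,y)}$, and some 1-form $\beta$. It is an $(\alpha,\beta)$-metric if $F=\alpha\phi(\beta/\alpha)$ with $\phi:(-b_0,b_0)\to\mathbb{R}^+$ a $C^\infty$ function of one variable satisfying $\phi(s)-s\phi'(s)+(b^2-s^2)\phi''(s)>0$ for $|s|\le b<b_0$, and $\|\beta\|_\alpha<b_0$. Either is said to be defined by $g$ and $X$ if $\beta(y)=g(X,y)$. For $a\in G$ let $\tau_a:G/H\to G/H$, $\tau_a(xH)=axH$. A Riemannian metric $g$ is $G$-invariant if every $\tau_a$ is an isometry; a vector field $X$ is $G$-invariant if $d\tau_aX=X$ for all $a\in G$; a Finsler metric $F$ is $G$-invariant if $F(\tau_a(x),d\tau_a y)=F(x,y)$ for all $a\in G$, $x\in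 M$, $y\in T_xM$. For a Lie group take $H$ trivial, and $G$-invariant means left-invariant. *)

theory Defs
  imports "HOL-Analysis.Analysis" "HOL-Algebra.Left_Coset"
begin

section \<open>Smooth manifolds\<close>

text \<open>
  The predicates \<open>Ck_on\<close> and \<open>smooth_on\<close> have their usual meaning (class C^k, C^infinity)
  for open subsets of Euclidean spaces, and are only used there.
\<close>

primrec Ck_on :: "nat \<Rightarrow> 'a::euclidean_space set \<Rightarrow> ('a \<Rightarrow> 'b::real_normed_vector) \<Rightarrow> bool" where
  "Ck_on 0 S f \<longleftrightarrow> continuous_on S f"
| "Ck_on (Suc k) S f \<longleftrightarrow>
     (\<forall>x\<in>S. f differentiable (at x)) \<and> (\<forall>v. Ck_on k S (\<lambda>x. frechet_derivative f (at x) v))"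

definition smooth_on :: "'a::euclidean_space set \<Rightarrow> ('a \<Rightarrow> 'b::real_normed_vector) \<Rightarrow> bool" where
  "smooth_on S f \<longleftrightarrow> (\<forall>k. Ck_on k S f)"

text \<open>
  A chart is a pair of its domain and a map that is relevant on this domain only. Atlases are
  not required to be maximal.
\<close>

type_synonym ('p, 'e) chart = "'p set \<times> ('p \<Rightarrow> 'e)"

record ('p, 'e) manifold =
  mtop :: "'p topology"
  atlas :: "('p, 'e) chart set"

abbreviation points :: "('p, 'e) manifold \<Rightarrow> 'p set" where
  "points M \<equiv> topspace (mtop M)"

abbreviation param :: "('p, 'e) chart \<Rightarrow> 'e \<Rightarrow> 'p" where
  "param c \<equiv> inv_into (fst c) (snd c)"

definition charts_at :: "('p, 'e) manifold \<Rightarrow> 'p \<Rightarrow> ('p, 'e) chart set" where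
  "charts_at M p = {c \<in> atlas M. p \<in> fst c}"

definition smooth_manifold :: "('p, 'e::euclidean_space) manifold \<Rightarrow> bool" where
  "smooth_manifold M \<longleftrightarrow>
     Hausdorff_space (mtop M) \<and> second_countable (mtop M) \<and>
     (\<Union>c\<in>atlas M. fst c) = points M \<and>
     (\<forall>(U, \<xi>)\<in>atlas M. openin (mtop M) U \<and> open (\<xi> ` U) \<and>
        homeomorphic_map (subtopology (mtop M) U) (top_of_set (\<xi> ` U)) \<xi>) \<and>
     (\<forall>(U, \<xi>)\<in>atlas M. \<forall>(V, \<eta>)\<in>atlas M. smooth_on (\<xi> ` (U \<inter> V)) (\<eta> \<circ> inv_into U \<xi>))"

definition smooth_map ::
  "('p, 'e::euclidean_space) manifold \<Rightarrow> ('q, 'f::euclidean_space) manifold \<Rightarrow> ('p \<Rightarrow> 'q) \<Rightarrow> bool" where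
  "smooth_map M N f \<longleftrightarrow>
     continuous_map (mtop M) (mtop N) f \<and>
     (\<forall>(U, \<xi>)\<in>atlas M. \<forall>(V, \<eta>)\<in>atlas N.
        smooth_on (\<xi> ` {p \<in> U. f p \<in> V}) (\<eta> \<circ> f \<circ> inv_into U \<xi>))"

definition diffeomorphism ::
  "('p, 'e::euclidean_space) manifold \<Rightarrow> ('q, 'f::euclidean_space) manifold \<Rightarrow> ('p \<Rightarrow> 'q) \<Rightarrow> bool" where
  "diffeomorphism M N f \<longleftrightarrow>
     bij_betw f (points M) (points N) \<and> smooth_map M N f \<and> smooth_map N M (inv_into (points M) f)"

definition prod_manifold ::
  "('p, 'e::euclidean_space) manifold \<Rightarrow> ('q, 'f::euclidean_space) manifold \<Rightarrow> ('p \<times> 'q, 'e \<times> 'f) manifold" where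
  "prod_manifold M N =
     \<lparr>mtop = prod_topology (mtop M) (mtop N),
      atlas = {(U \<times> V, \<lambda>(p, q). (\<xi> p, \<eta> q)) | U \<xi> V \<eta>. (U, \<xi>) \<in> atlas M \<and> (V, \<eta>) \<in> atlas N}\<rparr>"

definition real_line :: "(real, real) manifold" where
  "real_line = \<lparr>mtop = euclideanreal, atlas = {(UNIV, id)}\<rparr>"

definition smooth_fun_on :: "('p, 'e::euclidean_space) chart set \<Rightarrow> 'p set \<Rightarrow> ('p \<Rightarrow> real) \<Rightarrow> bool" where
  "smooth_fun_on A D f \<longleftrightarrow> (\<forall>(U, \<xi>)\<in>A. smooth_on (\<xi> ` (U \<inter> D)) (f \<circ> inv_into U \<xi>))"


section \<open>Tangent vectors\<close>

text \<open>
  A tangent vector at \<open>p\<close> is the family of its coordinate representations in all charts around \<open>p\<close>,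
  related by the derivatives of the transition maps; it is set to 0 on all other charts. The vector
  space operations are the pointwise ones.
\<close>

type_synonym ('p, 'e) tvec = "('p, 'e) chart \<Rightarrow> 'e"

definition tangent_space :: "('p, 'e::euclidean_space) manifold \<Rightarrow> 'p \<Rightarrow> ('p, 'e) tvec set" where
  "tangent_space M p =
     {v. (\<forall>c. c \<notin> charts_at M p \<longrightarrow> v c = 0) \<and>
         (\<forall>c\<in>charts_at M p. \<forall>d\<in>charts_at M p.
            v d = frechet_derivative (snd d \<circ> param c) (at (snd c p)) (v c))}"

definition tzero :: "('p, 'e::euclidean_space) tvec" where
  "tzero = (\<lambda>c. 0)"

definition tadd :: "('p, 'e::euclidean_space) tvec \<Rightarrow> ('p, 'e) tvec \<Rightarrow> ('p, 'e) tvec" where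
  "tadd v w = (\<lambda>c. v c + w c)"

definition tscale :: "real \<Rightarrow> ('p, 'e::euclidean_space) tvec \<Rightarrow> ('p, 'e) tvec" where
  "tscale r v = (\<lambda>c. r *\<^sub>R v c)"

text \<open>The tangent vector at \<open>p\<close> whose coordinates in the chart \<open>c\<close> are \<open>e\<close>.\<close>

definition coord_vector :: "('p, 'e::euclidean_space) manifold \<Rightarrow> ('p, 'e) chart \<Rightarrow> 'e \<Rightarrow> 'p \<Rightarrow> ('p, 'e) tvec" where
  "coord_vector M c e p = inv_into (tangent_space M p) (\<lambda>v. v c) e"

text \<open>By the chain rule the differential does not depend on the chart chosen around \<open>p\<close>.\<close>

definition differential ::
  "('p, 'e::euclidean_space) manifold \<Rightarrow> ('q, 'f::euclidean_space) manifold \<Rightarrow> ('p \<Rightarrow> 'q) \<Rightarrow>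
   'p \<Rightarrow> ('p, 'e) tvec \<Rightarrow> ('q, 'f) tvec" where
  "differential M N f p v =
     (let c = (SOME c. c \<in> charts_at M p) in
      (\<lambda>d. if d \<in> charts_at N (f p)
           then frechet_derivative (snd d \<circ> f \<circ> param c) (at (snd c p)) (v c)
           else 0))"

definition submersion ::
  "('p, 'e::euclidean_space) manifold \<Rightarrow> ('q, 'f::euclidean_space) manifold \<Rightarrow> ('p \<Rightarrow> 'q) \<Rightarrow> bool" where
  "submersion M N f \<longleftrightarrow>
     smooth_map M N f \<and>
     (\<forall>p\<in>points M. differential M N f p ` tangent_space M p = tangent_space N (f p))"

text \<open>The standard charts of the tangent bundle, whose points are the pairs \<open>(p, v)\<close>.\<close>

definition tangent_atlas :: "('p, 'e::euclidean_space) manifold \<Rightarrow> ('p \<times> ('p, 'e) tvec, 'e \<times> 'e) chart set" where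
  "tangent_atlas M =
     {(Sigma U (tangent_space M), \<lambda>(p, v). (\<xi> p, v (U, \<xi>))) | U \<xi>. (U, \<xi>) \<in> atlas M}"

definition vector_field :: "('p, 'e::euclidean_space) manifold \<Rightarrow> ('p \<Rightarrow> ('p, 'e) tvec) \<Rightarrow> bool" where
  "vector_field M X \<longleftrightarrow>
     (\<forall>p\<in>points M. X p \<in> tangent_space M p) \<and>
     (\<forall>c\<in>atlas M. smooth_on (snd c ` fst c) (\<lambda>u. X (param c u) c))"

definition one_form :: "('p, 'e::euclidean_space) manifold \<Rightarrow> ('p \<Rightarrow> ('p, 'e) tvec \<Rightarrow> real) \<Rightarrow> bool" where
  "one_form M \<beta> \<longleftrightarrow>
     (\<forall>p\<in>points M. \<forall>v\<in>tangent_space M p. \<forall>w\<in>tangent_space M p. \<forall>r.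
        \<beta> p (tadd v w) = \<beta> p v + \<beta> p w \<and> \<beta> p (tscale r v) = r * \<beta> p v) \<and>
     (\<forall>c\<in>atlas M. \<forall>e. smooth_on (snd c ` fst c)
        (\<lambda>u. \<beta> (param c u) (coord_vector M c e (param c u))))"

definition riemannian_metric ::
  "('p, 'e::euclidean_space) manifold \<Rightarrow> ('p \<Rightarrow> ('p, 'e) tvec \<Rightarrow> ('p, 'e) tvec \<Rightarrow> real) \<Rightarrow> bool" where
  "riemannian_metric M g \<longleftrightarrow>
     (\<forall>p\<in>points M. \<forall>v\<in>tangent_space M p. \<forall>w\<in>tangent_space M p.
        g p v w = g p w v \<and>
        (v \<noteq> tzero \<longrightarrow> g p v v > 0) \<and>
        (\<forall>r. g p (tscale r v) w = r * g p v w) \<and>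
        (\<forall>z\<in>tangent_space M p. g p (tadd v w) z = g p v z + g p w z)) \<and>
     (\<forall>c\<in>atlas M. \<forall>e e'. smooth_on (snd c ` fst c)
        (\<lambda>u. g (param c u) (coord_vector M c e (param c u)) (coord_vector M c e' (param c u))))"

definition isometry ::
  "('p, 'e::euclidean_space) manifold \<Rightarrow> ('p \<Rightarrow> ('p, 'e) tvec \<Rightarrow> ('p, 'e) tvec \<Rightarrow> real) \<Rightarrow> ('p \<Rightarrow> 'p) \<Rightarrow> bool" where
  "isometry M g f \<longleftrightarrow>
     diffeomorphism M M f \<and>
     (\<forall>p\<in>points M. \<forall>v\<in>tangent_space M p. \<forall>w\<in>tangent_space M p.
        g (f p) (differential M M f p v) (differential M M f p w) = g p v w)"


section \<open>Finsler metrics\<close>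

text \<open>\<open>g\<^sub>y(u, v) = 1/2 \<cdot> \<partial>\<^sup>2/\<partial>s\<partial>t F\<^sup>2(p, y + s u + t v)\<close> at \<open>s = t = 0\<close>.\<close>

definition fundamental_tensor ::
  "('p \<Rightarrow> ('p, 'e::euclidean_space) tvec \<Rightarrow> real) \<Rightarrow> 'p \<Rightarrow>
   ('p, 'e) tvec \<Rightarrow> ('p, 'e) tvec \<Rightarrow> ('p, 'e) tvec \<Rightarrow> real" where
  "fundamental_tensor F p y u v =
     deriv (\<lambda>s. deriv (\<lambda>t. (F p (tadd y (tadd (tscale s u) (tscale t v))))\<^sup>2) 0) 0 / 2"

definition finsler_metric ::
  "('p, 'e::euclidean_space) manifold \<Rightarrow> ('p \<Rightarrow> ('p, 'e) tvec \<Rightarrow> real) \<Rightarrow> bool" where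
  "finsler_metric M F \<longleftrightarrow>
     (\<forall>p\<in>points M. \<forall>y\<in>tangent_space M p. 0 \<le> F p y) \<and>
     smooth_fun_on (tangent_atlas M) {(p, y). y \<noteq> tzero} (\<lambda>(p, y). F p y) \<and>
     (\<forall>p\<in>points M. \<forall>y\<in>tangent_space M p. \<forall>r>0. F p (tscale r y) = r * F p y) \<and>
     (\<forall>p\<in>points M. \<forall>y\<in>tangent_space M p - {tzero}. \<forall>u\<in>tangent_space M p - {tzero}.
        fundamental_tensor F p y u u > 0)"

definition alpha_norm ::
  "('p \<Rightarrow> ('p, 'e::euclidean_space) tvec \<Rightarrow> ('p, 'e) tvec \<Rightarrow> real) \<Rightarrow> 'p \<Rightarrow> ('p, 'e) tvec \<Rightarrow> real" where
  "alpha_norm g p y = sqrt (g p y y)"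

definition conorm ::
  "('p, 'e::euclidean_space) manifold \<Rightarrow> ('p \<Rightarrow> ('p, 'e) tvec \<Rightarrow> ('p, 'e) tvec \<Rightarrow> real) \<Rightarrow>
   ('p \<Rightarrow> ('p, 'e) tvec \<Rightarrow> real) \<Rightarrow> 'p \<Rightarrow> real" where
  "conorm M g \<beta> p = (SUP y\<in>tangent_space M p - {tzero}. \<bar>\<beta> p y\<bar> / alpha_norm g p y)"

text \<open>
  The domain \<open>D\<close> of \<open>\<phi>(x, s)\<close> may be any open subset of \<open>M \<times> \<real>\<close> that contains all \<open>(x, s)\<close> with
  \<open>\<bar>s\<bar> \<le> \<parallel>\<beta>\<^sub>x\<parallel>\<close>, for instance \<open>M \<times> \<real>\<close>, or \<open>M \<times> (-b\<^sub>0, b\<^sub>0)\<close> when \<open>\<parallel>\<beta>\<^sub>x\<parallel> < b\<^sub>0\<close>.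
\<close>

definition general_alpha_beta_metric ::
  "('p, 'e::euclidean_space) manifold \<Rightarrow> ('p \<Rightarrow> ('p, 'e) tvec \<Rightarrow> ('p, 'e) tvec \<Rightarrow> real) \<Rightarrow>
   ('p \<Rightarrow> ('p, 'e) tvec \<Rightarrow> real) \<Rightarrow> ('p \<Rightarrow> ('p, 'e) tvec \<Rightarrow> real) \<Rightarrow> bool" where
  "general_alpha_beta_metric M g \<beta> F \<longleftrightarrow>
     finsler_metric M F \<and> riemannian_metric M g \<and> one_form M \<beta> \<and>
     (\<exists>D \<phi>. openin (mtop (prod_manifold M real_line)) D \<and>
        (\<forall>p\<in>points M. \<forall>s. \<bar>s\<bar> \<le> conorm M g \<beta> p \<longrightarrow> (p, s) \<in> D) \<and>
        smooth_fun_on (atlas (prod_manifold M real_line)) D (\<lambda>(p, s). \<phi> p s) \<and>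
        (\<forall>p\<in>points M. \<forall>y\<in>tangent_space M p - {tzero}.
           F p y = alpha_norm g p y * \<phi> p (\<beta> p y / alpha_norm g p y)))"

text \<open>
  The inequality for \<open>\<phi>\<close> is required for all real \<open>s\<close>, \<open>b\<close> with \<open>\<bar>s\<bar> \<le> b < b\<^sub>0\<close>, not only for
  \<open>b = \<parallel>\<beta>\<^sub>x\<parallel>\<close>; \<open>b\<^sub>0 = \<infinity>\<close> is allowed.
\<close>

definition alpha_beta_metric ::
  "('p, 'e::euclidean_space) manifold \<Rightarrow> ('p \<Rightarrow> ('p, 'e) tvec \<Rightarrow> ('p, 'e) tvec \<Rightarrow> real) \<Rightarrow>
   ('p \<Rightarrow> ('p, 'e) tvec \<Rightarrow> real) \<Rightarrow> ('p \<Rightarrow> ('p, 'e) tvec \<Rightarrow> real) \<Rightarrow> bool" where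
  "alpha_beta_metric M g \<beta> F \<longleftrightarrow>
     finsler_metric M F \<and> riemannian_metric M g \<and> one_form M \<beta> \<and>
     (\<exists>(b\<^sub>0::ereal) (\<phi>::real \<Rightarrow> real). 0 < b\<^sub>0 \<and>
        smooth_on {s. ereal \<bar>s\<bar> < b\<^sub>0} \<phi> \<and>
        (\<forall>s. ereal \<bar>s\<bar> < b\<^sub>0 \<longrightarrow> 0 < \<phi> s) \<and>
        (\<forall>s b. \<bar>s\<bar> \<le> b \<and> ereal b < b\<^sub>0 \<longrightarrow>
           0 < \<phi> s - s * deriv \<phi> s + (b\<^sup>2 - s\<^sup>2) * deriv (deriv \<phi>) s) \<and>
        (\<forall>p\<in>points M. ereal (conorm M g \<beta> p) < b\<^sub>0) \<and>
        (\<forall>p\<in>points M. \<forall>y\<in>tangent_space M p - {tzero}.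
           F p y = alpha_norm g p y * \<phi> (\<beta> p y / alpha_norm g p y)))"

definition dual_form ::
  "('p \<Rightarrow> ('p, 'e::euclidean_space) tvec \<Rightarrow> ('p, 'e) tvec \<Rightarrow> real) \<Rightarrow> ('p \<Rightarrow> ('p, 'e) tvec) \<Rightarrow>
   'p \<Rightarrow> ('p, 'e) tvec \<Rightarrow> real" where
  "dual_form g X p y = g p (X p) y"

abbreviation general_alpha_beta_metric_by where
  "general_alpha_beta_metric_by M g X F \<equiv> general_alpha_beta_metric M g (dual_form g X) F"

abbreviation alpha_beta_metric_by where
  "alpha_beta_metric_by M g X F \<equiv> alpha_beta_metric M g (dual_form g X) F"


section \<open>Lie groups, homogeneous spaces and invariance\<close>

definition lie_group :: "('a, 'r) monoid_scheme \<Rightarrow> ('a, 'e::euclidean_space) manifold \<Rightarrow> bool" where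
  "lie_group G GM \<longleftrightarrow>
     group G \<and> smooth_manifold GM \<and> points GM = carrier G \<and>
     smooth_map (prod_manifold GM GM) GM (\<lambda>(a, b). a \<otimes>\<^bsub>G\<^esub> b) \<and>
     smooth_map GM GM (\<lambda>a. inv\<^bsub>G\<^esub> a)"

text \<open>
  \<open>M\<close> is \<open>G/H\<close> for a closed subgroup \<open>H\<close>, with its usual manifold structure, which is the
  only one for which the projection \<open>G \<rightarrow> G/H\<close> is a submersion.
\<close>

definition homogeneous_space ::
  "('a, 'r) monoid_scheme \<Rightarrow> ('a, 'e::euclidean_space) manifold \<Rightarrow> 'a set \<Rightarrow>
   ('a set, 'f::euclidean_space) manifold \<Rightarrow> bool" where
  "homogeneous_space G GM H M \<longleftrightarrow>
     lie_group G GM \<and> subgroup H G \<and> closedin (mtop GM) H \<and>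
     smooth_manifold M \<and> points M = lcosets\<^bsub>G\<^esub> H \<and>
     submersion GM M (\<lambda>a. a <#\<^bsub>G\<^esub> H)"

text \<open>
  \<open>coset_translation G a\<close> maps \<open>xH\<close> to \<open>axH\<close>, since \<open>a <#\<^bsub>G\<^esub> C\<close> is the set of all products
  \<open>a c\<close> with \<open>c \<in> C\<close>.
\<close>

definition coset_translation :: "('a, 'r) monoid_scheme \<Rightarrow> 'a \<Rightarrow> 'a set \<Rightarrow> 'a set" where
  "coset_translation G a C = a <#\<^bsub>G\<^esub> C"

definition left_translation :: "('a, 'r) monoid_scheme \<Rightarrow> 'a \<Rightarrow> 'a \<Rightarrow> 'a" where
  "left_translation G a x = a \<otimes>\<^bsub>G\<^esub> x"

text \<open>Invariance under the transformations \<open>\<tau> a\<close>, \<open>a \<in> G\<close>, of \<open>M\<close>.\<close>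

definition invariant_riemannian ::
  "('a, 'r) monoid_scheme \<Rightarrow> ('a \<Rightarrow> 'p \<Rightarrow> 'p) \<Rightarrow> ('p, 'e::euclidean_space) manifold \<Rightarrow>
   ('p \<Rightarrow> ('p, 'e) tvec \<Rightarrow> ('p, 'e) tvec \<Rightarrow> real) \<Rightarrow> bool" where
  "invariant_riemannian G \<tau> M g \<longleftrightarrow> (\<forall>a\<in>carrier G. isometry M g (\<tau> a))"

definition invariant_vector_field ::
  "('a, 'r) monoid_scheme \<Rightarrow> ('a \<Rightarrow> 'p \<Rightarrow> 'p) \<Rightarrow> ('p, 'e::euclidean_space) manifold \<Rightarrow>
   ('p \<Rightarrow> ('p, 'e) tvec) \<Rightarrow> bool" where
  "invariant_vector_field G \<tau> M X \<longleftrightarrow>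
     (\<forall>a\<in>carrier G. \<forall>p\<in>points M. differential M M (\<tau> a) p (X p) = X (\<tau> a p))"

definition invariant_finsler ::
  "('a, 'r) monoid_scheme \<Rightarrow> ('a \<Rightarrow> 'p \<Rightarrow> 'p) \<Rightarrow> ('p, 'e::euclidean_space) manifold \<Rightarrow>
   ('p \<Rightarrow> ('p, 'e) tvec \<Rightarrow> real) \<Rightarrow> bool" where
  "invariant_finsler G \<tau> M F \<longleftrightarrow>
     (\<forall>a\<in>carrier G. \<forall>p\<in>points M. \<forall>y\<in>tangent_space M p.
        F (\<tau> a p) (differential M M (\<tau> a) p y) = F p y)"

end

theory Submission
  imports Defs
begin

text \<open>
  Let \<open>\<phi>(x, s)\<close> be the function that defines \<open>F\<close>. The group acts transitively and preserves \<open>F\<close>, \<open>g\<close> and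
  \<open>X\<close>, hence also \<open>\<alpha>\<close>, \<open>\<beta>\<close> and the constant \<open>b = \<parallel>\<beta>\<parallel> = \<alpha>(X)\<close>. Moving every tangent vector to one base
  point \<open>p\<close> therefore shows \<open>F = \<alpha> \<phi>(p, \<beta>/\<alpha>)\<close> everywhere
  (\<open>transitive_invariant_imp_alpha_beta\<close>). Homogeneous spaces and Lie groups are both instances, with the
  coset \<open>H\<close> and the unit element as base point.

  The remaining point is that an \<open>(\<alpha>, \<beta>)\<close>-metric requires
  \<open>\<phi>(s) - s \<phi>'(s) + (t\<^sup>2 - s\<^sup>2) \<phi>''(s) > 0\<close> for all \<open>\<bar>s\<bar> \<le> t < b\<^sub>0\<close> with some \<open>b\<^sub>0 > b\<close>, which has to
  come from the strong convexity of \<open>F\<close> at \<open>p\<close> (\<open>alpha_beta_profile_at_point\<close>).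

  Assume first that \<open>X\<close> belongs to a linearly independent pair of tangent vectors. Evaluating the
  fundamental tensor in their plane yields the inequality for \<open>t = b\<close> (\<open>profile_convexity\<close>).
  A minimum argument deduces \<open>\<phi> - s \<phi>' > 0\<close> on \<open>[-b, b]\<close> (\<open>tangent_intercept_pos\<close>). Since the
  expression is affine in \<open>t\<^sup>2\<close>, the inequality holds for all \<open>t \<le> b\<close>, and by compactness it extends to a
  slightly larger \<open>b\<^sub>0\<close> (\<open>profile_extends\<close>).

  Otherwise \<open>X = 0\<close> or the tangent spaces are lines spanned by \<open>X\<close>. Then \<open>\<beta>/\<alpha>\<close> takes the values \<open>\<plusminus>b\<close>
  only, convexity says nothing about the given \<open>\<phi>\<close> between them, and an affine profile with the same two
  values takes its place (\<open>affine_profile\<close>).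
\<close>

section \<open>Smooth functions in coordinates\<close>

text \<open>
  The derivatives in the definition of \<open>Ck_on\<close> are two-sided, so only on open sets does the class
  depend on the values inside the set alone.
\<close>

lemma Ck_on_cong:
  assumes "open T" "\<And>x. x \<in> T \<Longrightarrow> f x = g x" "Ck_on k T f"
  shows "Ck_on k T g"
  using assms(2,3)
proof (induction k arbitrary: f g)
  case 0
  then show ?case by (simp cong: continuous_on_cong)
next
  case (Suc k)
  have d: "(g has_derivative frechet_derivative f (at x)) (at x)" if "x \<in> T" for x
  proof (rule has_derivative_transform_within_open)
    show "(f has_derivative frechet_derivative f (at x)) (at x)"
      using Suc.prems(2) that by (simp add: frechet_derivative_works)
  qed (use assms(1) that Suc.prems(1) in auto)
  have eq: "frechet_derivative f (at x) = frechet_derivative g (at x)" if "x \<in> T" for x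
    using frechet_derivative_at[OF d[OF that]] .
  have "Ck_on k T (\<lambda>x. frechet_derivative g (at x) v)" for v
    by (rule Suc.IH[of "\<lambda>x. frechet_derivative f (at x) v"]) (use Suc.prems eq in auto)
  then show ?case using d by (auto simp: differentiable_def)
qed

lemma smooth_on_subset:
  assumes "smooth_on S f" "T \<subseteq> S"
  shows "smooth_on T f"
proof -
  have "Ck_on k S f \<Longrightarrow> Ck_on k T f" for k
    using assms(2) by (induction k arbitrary: f) (auto intro: continuous_on_subset)
  with assms(1) show ?thesis by (simp add: smooth_on_def)
qed

lemma smooth_on_differentiable:
  assumes "smooth_on S f" "x \<in> S"
  shows "f differentiable at x"
  using assms Ck_on.simps(2)[of 0 S f] unfolding smooth_on_def by blast

text \<open>
  Freezing the point of the manifold in a profile \<open>\<phi>(x, s)\<close> amounts, in a product chart, to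
  restricting a smooth function to a line; the chain rule with the affine map \<open>s \<mapsto> (u, s)\<close> turns
  directional derivatives into directional derivatives.
\<close>

lemma Ck_on_slice:
  fixes f :: "'a::euclidean_space \<times> 'b::euclidean_space \<Rightarrow> 'c::real_normed_vector"
  assumes "open T" "\<And>s. s \<in> T \<Longrightarrow> (u, s) \<in> S" "Ck_on k S f"
  shows "Ck_on k T (\<lambda>s. f (u, s))"
  using assms(3)
proof (induction k arbitrary: f)
  case 0
  then show ?case using assms(2)
    by (auto intro!: continuous_on_compose2[of S f] continuous_intros)
next
  case (Suc k)
  have d: "((\<lambda>s. f (u, s)) has_derivative (\<lambda>h. frechet_derivative f (at (u, s)) (0, h))) (at s)"
    if "s \<in> T" for s
  proof -
    have "(f has_derivative frechet_derivative f (at (u, s))) (at (u, s))"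
      using Suc.prems assms(2) that by (simp add: frechet_derivative_works)
    moreover have "((\<lambda>s. (u, s)) has_derivative (\<lambda>h. (0, h))) (at s)"
      by (intro derivative_intros)
    ultimately show ?thesis by (rule has_derivative_compose[rotated])
  qed
  have "Ck_on k T (\<lambda>s. frechet_derivative (\<lambda>s. f (u, s)) (at s) v)" for v
  proof (rule Ck_on_cong)
    show "Ck_on k T (\<lambda>s. frechet_derivative f (at (u, s)) (0, v))"
      using Suc.IH[of "\<lambda>x. frechet_derivative f (at x) (0, v)"] Suc.prems by simp
    show "frechet_derivative f (at (u, s)) (0, v) = frechet_derivative (\<lambda>s. f (u, s)) (at s) v"
      if "s \<in> T" for s
      by (simp flip: frechet_derivative_at[OF d[OF that]])
  qed (rule assms(1))
  then show ?case using d by (auto simp: differentiable_def)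
qed

lemma smooth_on_has_real_derivative:
  fixes f :: "real \<Rightarrow> real"
  assumes "smooth_on T f" "s \<in> T"
  shows "(f has_real_derivative deriv f s) (at s)"
  using smooth_on_differentiable[OF assms]
  by (simp add: DERIV_deriv_iff_real_differentiable)

lemma smooth_on_deriv:
  fixes f :: "real \<Rightarrow> real"
  assumes "smooth_on T f" "open T"
  shows "smooth_on T (deriv f)"
  unfolding smooth_on_def
proof
  fix k
  have "Ck_on k T (\<lambda>s. frechet_derivative f (at s) 1)"
    using assms(1) Ck_on.simps(2)[of k T f] unfolding smooth_on_def by blast
  moreover have "frechet_derivative f (at s) 1 = deriv f s" if "s \<in> T" for s
  proof -
    have "(f has_derivative (*) (deriv f s)) (at s)"
      using smooth_on_has_real_derivative[OF assms(1) that] by (simp add: has_field_derivative_def)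
    then show ?thesis by (simp flip: frechet_derivative_at)
  qed
  ultimately show "Ck_on k T (deriv f)"
    by (rule Ck_on_cong[OF assms(2), rotated])
qed

lemma smooth_on_continuous: "smooth_on S f \<Longrightarrow> continuous_on S f"
  unfolding smooth_on_def by (metis Ck_on.simps(1))

lemma smooth_on_affine: "smooth_on S (\<lambda>s::real. A + B * s :: real)"
proof -
  have const: "Ck_on k S (\<lambda>s::real. c::real)" for k c
    by (induction k arbitrary: c) simp_all
  have d: "((\<lambda>s. A + B * s) has_derivative (\<lambda>h. B * h)) (at s)" for s
    by (auto intro!: derivative_eq_intros)
  have "Ck_on k S (\<lambda>s. A + B * s)" for k
  proof (cases k)
    case 0
    then show ?thesis by (simp add: continuous_intros)
  next
    case (Suc j)
    have "frechet_derivative (\<lambda>s. A + B * s) (at s) = (\<lambda>h. B * h)" for s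
      using frechet_derivative_at[OF d] by simp
    with Suc d const show ?thesis by (auto simp: differentiable_def)
  qed
  then show ?thesis by (simp add: smooth_on_def)
qed

section \<open>Charts and tangent vectors\<close>

lemma charts_at_props:
  assumes "smooth_manifold M" "c \<in> charts_at M p"
  shows "c \<in> atlas M" "p \<in> fst c" "openin (mtop M) (fst c)" "inj_on (snd c) (fst c)"
    "param c (snd c p) = p"
proof -
  show c: "c \<in> atlas M" and p: "p \<in> fst c" using assms(2) by (auto simp: charts_at_def)
  obtain U \<xi> where [simp]: "c = (U, \<xi>)" by (cases c)
  have "homeomorphic_map (subtopology (mtop M) U) (top_of_set (\<xi> ` U)) \<xi>"
    and o: "openin (mtop M) U"
    using assms(1) c unfolding smooth_manifold_def by auto
  then show "inj_on (snd c) (fst c)"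
    using openin_subset[OF o]
    by (simp add: homeomorphic_map_def Int_absorb1)
  then show "param c (snd c p) = p" using p by simp
  show "openin (mtop M) (fst c)" using o by simp
qed

lemma open_chart_image:
  assumes "smooth_manifold M" "(U, \<xi>) \<in> atlas M" "openin (mtop M) W" "W \<subseteq> U"
  shows "open (\<xi> ` W)"
proof -
  have h: "homeomorphic_map (subtopology (mtop M) U) (top_of_set (\<xi> ` U)) \<xi>"
    and "open (\<xi> ` U)"
    using assms(1,2) unfolding smooth_manifold_def by auto
  have "openin (subtopology (mtop M) U) W"
    using assms(3,4) by (simp add: openin_subtopology_alt openin_subset inf.absorb2 image_iff) (metis inf.absorb2)
  with h have "openin (top_of_set (\<xi> ` U)) (\<xi> ` W)"
    using homeomorphic_imp_open_map open_map_def by blast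
  with \<open>open (\<xi> ` U)\<close> show ?thesis using openin_open_trans by blast
qed

lemma ex_chart_at:
  assumes "smooth_manifold M" "p \<in> points M"
  obtains c where "c \<in> charts_at M p"
  using assms unfolding smooth_manifold_def charts_at_def by blast

lemma smooth_map_id: "smooth_manifold M \<Longrightarrow> smooth_map M M (\<lambda>p. p)"
  unfolding smooth_map_def smooth_manifold_def
  by (auto simp: Int_def comp_def)

lemma transition_has_derivative:
  assumes M: "smooth_manifold M" and c: "c \<in> charts_at M p" and d: "d \<in> charts_at M p"
  shows "(snd d \<circ> param c has_derivative frechet_derivative (snd d \<circ> param c) (at (snd c p)))
          (at (snd c p))"
proof -
  have "smooth_on (snd c ` (fst c \<inter> fst d)) (snd d \<circ> param c)"
    using M c d unfolding smooth_manifold_def charts_at_def by fastforce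
  moreover have "snd c p \<in> snd c ` (fst c \<inter> fst d)"
    using c d by (auto simp: charts_at_def)
  ultimately show ?thesis
    by (simp add: smooth_on_differentiable frechet_derivative_works[symmetric])
qed

lemma local_representative_has_derivative:
  assumes f: "smooth_map M N f" and c: "c \<in> charts_at M p" and d: "d \<in> charts_at N (f p)"
  shows "(snd d \<circ> f \<circ> param c has_derivative
           frechet_derivative (snd d \<circ> f \<circ> param c) (at (snd c p))) (at (snd c p))"
proof -
  have "smooth_on (snd c ` {q \<in> fst c. f q \<in> fst d}) (snd d \<circ> f \<circ> param c)"
    using f c d unfolding smooth_map_def charts_at_def by fastforce
  moreover have "snd c p \<in> snd c ` {q \<in> fst c. f q \<in> fst d}"
    using c d by (auto simp: charts_at_def)
  ultimately show ?thesis
    by (simp add: smooth_on_differentiable frechet_derivative_works[symmetric])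
qed

text \<open>
  The coordinates of a pushed-forward vector in two charts \<open>d\<close> and \<open>d'\<close> are related by the transition
  map because, near the base point, the representative of \<open>f\<close> in \<open>d'\<close> is the representative in \<open>d\<close>
  followed by the transition map. For \<open>f = id\<close> this produces tangent vectors with prescribed
  coordinates.
\<close>

lemma pushforward_in_tangent_space:
  assumes M: "smooth_manifold M" and N: "smooth_manifold N" and f: "smooth_map M N f"
    and c: "c \<in> charts_at M p"
  shows "(\<lambda>d. if d \<in> charts_at N (f p)
              then frechet_derivative (snd d \<circ> f \<circ> param c) (at (snd c p)) e else 0)
          \<in> tangent_space N (f p)"
proof -
  have chain: "frechet_derivative (snd d' \<circ> f \<circ> param c) (at (snd c p)) e =
          frechet_derivative (snd d' \<circ> param d) (at (snd d (f p)))
            (frechet_derivative (snd d \<circ> f \<circ> param c) (at (snd c p)) e)"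
    if d: "d \<in> charts_at N (f p)" and d': "d' \<in> charts_at N (f p)" for d d'
  proof -
    note pc = charts_at_props[OF M c] and pd = charts_at_props[OF N d]
    define W where "W = {q \<in> fst c. f q \<in> fst d}"
    have cont: "continuous_map (mtop M) (mtop N) f" using f by (simp add: smooth_map_def)
    have "W = fst c \<inter> {q \<in> points M. f q \<in> fst d}"
      using openin_subset[OF pc(3)] by (auto simp: W_def)
    then have "openin (mtop M) W"
      using openin_continuous_map_preimage[OF cont pd(3)] pc(3) by auto
    then have "open (snd c ` W)"
      using open_chart_image[of M "fst c" "snd c" W] M pc(1) by (auto simp: W_def)
    moreover have "snd c p \<in> snd c ` W" using pc(2) pd(2) by (auto simp: W_def)
    moreover have "(snd d' \<circ> param d \<circ> (snd d \<circ> f \<circ> param c)) u = (snd d' \<circ> f \<circ> param c) u"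
      if "u \<in> snd c ` W" for u
      using that pc(4) pd(4) by (auto simp: W_def)
    moreover have "(snd d' \<circ> param d \<circ> (snd d \<circ> f \<circ> param c) has_derivative
        frechet_derivative (snd d' \<circ> param d) (at (snd d (f p))) \<circ>
        frechet_derivative (snd d \<circ> f \<circ> param c) (at (snd c p))) (at (snd c p))"
      using local_representative_has_derivative[OF f c d] transition_has_derivative[OF N d d'] pc(5)
      by (auto intro!: diff_chain_at)
    ultimately have "(snd d' \<circ> f \<circ> param c has_derivative
        frechet_derivative (snd d' \<circ> param d) (at (snd d (f p))) \<circ>
        frechet_derivative (snd d \<circ> f \<circ> param c) (at (snd c p))) (at (snd c p))"
      using has_derivative_transform_within_open by blast
    from frechet_derivative_at[OF this] show ?thesis by (metis comp_apply)
  qed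
  show ?thesis unfolding tangent_space_def mem_Collect_eq
  proof (intro conjI allI impI ballI)
    fix d d' assume d: "d \<in> charts_at N (f p)" and d': "d' \<in> charts_at N (f p)"
    show "(if d' \<in> charts_at N (f p)
           then frechet_derivative (snd d' \<circ> f \<circ> param c) (at (snd c p)) e else 0) =
          frechet_derivative (snd d' \<circ> param d) (at (snd d (f p)))
            (if d \<in> charts_at N (f p)
             then frechet_derivative (snd d \<circ> f \<circ> param c) (at (snd c p)) e else 0)"
      unfolding if_P[OF d] if_P[OF d'] by (rule chain[OF d d'])
  qed simp
qed

lemma differential_in_tangent_space:
  assumes "smooth_manifold M" "smooth_manifold N" "smooth_map M N f" "p \<in> points M"
  shows "differential M N f p v \<in> tangent_space N (f p)"
proof -
  have "(SOME c. c \<in> charts_at M p) \<in> charts_at M p"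
    using ex_chart_at[OF assms(1,4)] by (metis someI_ex)
  from pushforward_in_tangent_space[OF assms(1-3) this] show ?thesis
    by (simp add: differential_def Let_def)
qed

lemma tangent_space_nonzero:
  assumes M: "smooth_manifold M" and p: "p \<in> points M"
  obtains y where "y \<in> tangent_space M p" "y \<noteq> tzero"
proof -
  obtain c where c: "c \<in> charts_at M p" using ex_chart_at[OF M p] .
  note pc = charts_at_props[OF M c]
  obtain e :: 'b where e: "e \<noteq> 0" using nonzero_Basis nonempty_Basis by blast
  define y where "y = (\<lambda>d. if d \<in> charts_at M p
      then frechet_derivative (snd d \<circ> (\<lambda>q. q) \<circ> param c) (at (snd c p)) e else 0)"
  have "y \<in> tangent_space M p"
    using pushforward_in_tangent_space[OF M M smooth_map_id[OF M] c] by (simp add: y_def)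
  moreover have "(snd c \<circ> (\<lambda>q. q) \<circ> param c has_derivative (\<lambda>h. h)) (at (snd c p))"
  proof (rule has_derivative_transform_within_open[OF has_derivative_ident])
    show "open (snd c ` fst c)"
      using open_chart_image[of M "fst c" "snd c" "fst c"] M pc by simp
  qed (use pc in \<open>auto simp: f_inv_into_f\<close>)
  then have "y c = e" using c by (simp add: y_def flip: frechet_derivative_at)
  with e have "y \<noteq> tzero" by (auto simp: tzero_def)
  ultimately show thesis using that by blast
qed

lemma transition_linear:
  assumes "smooth_manifold M" "c \<in> charts_at M p" "d \<in> charts_at M p"
  shows "linear (frechet_derivative (snd d \<circ> param c) (at (snd c p)))"
  using transition_has_derivative[OF assms] has_derivative_linear by blast

lemma tangent_space_transition:
  assumes "v \<in> tangent_space M p" "c \<in> charts_at M p" "d \<in> charts_at M p"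
  shows "frechet_derivative (snd d \<circ> param c) (at (snd c p)) (v c) = v d"
  using assms unfolding tangent_space_def mem_Collect_eq by (blast intro: sym)

lemma tangent_space_outside: "v \<in> tangent_space M p \<Longrightarrow> c \<notin> charts_at M p \<Longrightarrow> v c = 0"
  unfolding tangent_space_def by blast

lemma tangent_space_tadd:
  assumes M: "smooth_manifold M" and v: "v \<in> tangent_space M p" and w: "w \<in> tangent_space M p"
  shows "tadd v w \<in> tangent_space M p"
  unfolding tangent_space_def mem_Collect_eq
proof (intro conjI allI impI ballI)
  fix c assume "c \<notin> charts_at M p"
  then show "tadd v w c = 0"
    using tangent_space_outside[OF v] tangent_space_outside[OF w] by (simp add: tadd_def)
next
  fix c d assume cd: "c \<in> charts_at M p" "d \<in> charts_at M p"
  show "tadd v w d = frechet_derivative (snd d \<circ> param c) (at (snd c p)) (tadd v w c)"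
    unfolding tadd_def linear_add[OF transition_linear[OF M cd]]
      tangent_space_transition[OF v cd] tangent_space_transition[OF w cd] ..
qed

lemma tangent_space_tscale:
  assumes M: "smooth_manifold M" and v: "v \<in> tangent_space M p"
  shows "tscale r v \<in> tangent_space M p"
  unfolding tangent_space_def mem_Collect_eq
proof (intro conjI allI impI ballI)
  fix c assume "c \<notin> charts_at M p"
  then show "tscale r v c = 0"
    using tangent_space_outside[OF v] by (simp add: tscale_def)
next
  fix c d assume cd: "c \<in> charts_at M p" "d \<in> charts_at M p"
  show "tscale r v d = frechet_derivative (snd d \<circ> param c) (at (snd c p)) (tscale r v c)"
    unfolding tscale_def linear_scale[OF transition_linear[OF M cd]]
      tangent_space_transition[OF v cd] ..
qed

text \<open>
  The domain of the profile function at a fixed point is a slice of \<open>D\<close>, hence open; this is what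
  leaves room beyond \<open>\<bar>s\<bar> \<le> b\<close> when the convexity inequality is extended.
\<close>

lemma smooth_on_fibre_profile:
  assumes M: "smooth_manifold M" and p: "p \<in> points M"
    and D: "openin (mtop (prod_manifold M real_line)) D"
    and \<phi>: "smooth_fun_on (atlas (prod_manifold M real_line)) D (\<lambda>(p, s). \<phi> p s)"
  shows "open {s. (p, s) \<in> D}" "smooth_on {s. (p, s) \<in> D} (\<phi> p)"
proof -
  have "continuous_map euclideanreal (prod_topology (mtop M) euclideanreal) (\<lambda>s. (p, s))"
    using p by (simp add: continuous_map_pairwise comp_def)
  from openin_continuous_map_preimage[OF this] D show op: "open {s. (p, s) \<in> D}"
    by (auto simp: prod_manifold_def real_line_def)
  obtain c where c: "c \<in> charts_at M p" using ex_chart_at[OF M p] .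
  note pc = charts_at_props[OF M c]
  define \<zeta> :: "'a \<times> real \<Rightarrow> 'b \<times> real" where "\<zeta> = (\<lambda>(q, s). (snd c q, id s))"
  let ?U = "fst c \<times> (UNIV :: real set)"
  have "(?U, \<zeta>) \<in> atlas (prod_manifold M real_line)"
  proof -
    have "(fst c, snd c) \<in> atlas M" "(UNIV, id) \<in> atlas real_line"
      using pc(1) by (simp_all add: real_line_def)
    then show ?thesis unfolding prod_manifold_def manifold.select_convs \<zeta>_def mem_Collect_eq
      by (intro exI conjI) (rule refl)
  qed
  with \<phi> have sm: "smooth_on (\<zeta> ` (?U \<inter> D)) ((\<lambda>(p, s). \<phi> p s) \<circ> inv_into ?U \<zeta>)"
    unfolding smooth_fun_on_def by blast
  have inj: "inj_on \<zeta> ?U" using pc(4) by (auto simp: \<zeta>_def inj_on_def)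
  have \<zeta>: "(snd c p, s) = \<zeta> (p, s)" for s by (simp add: \<zeta>_def)
  have "Ck_on k {s. (p, s) \<in> D} (\<lambda>s. ((\<lambda>(p, s). \<phi> p s) \<circ> inv_into ?U \<zeta>) (snd c p, s))" for k
  proof (rule Ck_on_slice[OF op])
    show "Ck_on k (\<zeta> ` (?U \<inter> D)) ((\<lambda>(p, s). \<phi> p s) \<circ> inv_into ?U \<zeta>)"
      using sm by (simp add: smooth_on_def)
    show "(snd c p, s) \<in> \<zeta> ` (?U \<inter> D)" if "s \<in> {s. (p, s) \<in> D}" for s
      unfolding \<zeta> using that pc(2) by blast
  qed
  moreover have "((\<lambda>(p, s). \<phi> p s) \<circ> inv_into ?U \<zeta>) (snd c p, s) = \<phi> p s" for s
    unfolding \<zeta> using inv_into_f_f[OF inj, of "(p, s)"] pc(2) by simp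
  ultimately show "smooth_on {s. (p, s) \<in> D} (\<phi> p)"
    by (simp add: smooth_on_def)
qed

section \<open>Strong convexity along a great circle\<close>

lemma iterated_deriv_translate:
  fixes f :: "real \<Rightarrow> real"
  assumes "\<And>r. (f has_real_derivative f' r) (at r)" "(f' has_real_derivative D) (at 0)"
  shows "deriv (\<lambda>s. deriv (\<lambda>t. f (s + t)) 0) 0 = D"
proof -
  have "deriv (\<lambda>t. f (s + t)) 0 = f' s" for s
  proof (rule DERIV_imp_deriv)
    show "((\<lambda>t. f (s + t)) has_real_derivative f' s) (at 0)"
      using DERIV_shift[of f "f' s" 0 s] assms(1)[of s] by (simp add: add.commute)
  qed
  then show ?thesis using assms(2) by (simp add: DERIV_imp_deriv)
qed

text \<open>
  Let \<open>e1, e2\<close> be orthonormal with \<open>\<beta>(e1) = b\<close> and \<open>\<beta>(e2) = 0\<close>. The function that is squared and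
  differentiated twice is \<open>F = \<alpha> \<phi>(\<beta>/\<alpha>)\<close> along the line \<open>r \<mapsto> y + r u\<close>, where
  \<open>y = c e1 + k e2\<close> lies on the unit circle, \<open>u = \<mu> y + n\<close>, and \<open>n = - k e1 + c e2\<close> is the unit
  tangent of the circle at \<open>y\<close>.
  The two summands on the right are \<open>(F')\<^sup>2\<close> and \<open>F F''\<close>. The first one would spoil a lower bound for
  the second, and the parameter \<open>\<mu>\<close> serves to make it vanish.

  The computation stays short because \<open>\<alpha> \<sigma> = L\<close> is affine in \<open>r\<close> for \<open>\<sigma> = \<beta>/\<alpha>\<close>: the derivative of \<open>\<alpha> \<phi>(\<sigma>)\<close> is
  \<open>\<alpha>' (\<phi> - \<sigma> \<phi>')(\<sigma>) + L' \<phi>'(\<sigma>)\<close>, and \<open>\<sigma>'\<close> does not occur in it.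
\<close>

lemma second_derivative_along_circle:
  fixes \<phi> :: "real \<Rightarrow> real" and b c k \<mu> :: real
  defines "s \<equiv> b * c"
  defines "N \<equiv> (\<lambda>r. (1 + \<mu> * r)\<^sup>2 + r\<^sup>2)"
  assumes T: "open T" "{-b..b} \<subseteq> T" "smooth_on T \<phi>" and b: "0 \<le> b" and ck: "c\<^sup>2 + k\<^sup>2 = 1"
  shows "deriv (\<lambda>p. deriv (\<lambda>q. (\<lambda>r. (sqrt (N r) * \<phi> (b * (c * (1 + \<mu> * r) - k * r) / sqrt (N r)))\<^sup>2) (p + q)) 0) 0
      = 2 * ((\<mu> * \<phi> s - b * k * deriv \<phi> s)\<^sup>2
             + \<phi> s * (\<phi> s - s * deriv \<phi> s + (b\<^sup>2 - s\<^sup>2) * deriv (deriv \<phi>) s))"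
proof -
  define a where "a r = sqrt (N r)" for r
  define a' where "a' r = (\<mu> * (1 + \<mu> * r) + r) / a r" for r
  define L where "L r = b * (c * (1 + \<mu> * r) - k * r)" for r
  define L' where "L' = b * (c * \<mu> - k)"
  define \<sigma> where "\<sigma> r = L r / a r" for r
  define \<sigma>' where "\<sigma>' r = (L' - \<sigma> r * a' r) / a r" for r
  define h where "h x = \<phi> x - x * deriv \<phi> x" for x
  define P where "P r = a r * \<phi> (\<sigma> r)" for r
  define P' where "P' r = a' r * h (\<sigma> r) + L' * deriv \<phi> (\<sigma> r)" for r
  have N: "0 < N r" for r
    unfolding N_def by (cases "r = 0") (auto intro: add_nonneg_pos)
  then have a: "0 < a r" for r by (simp add: a_def)
  have a2: "(a r)\<^sup>2 = N r" for r using N[of r] by (simp add: a_def)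
  have \<sigma>T: "\<sigma> r \<in> T" for r
  proof -
    (* beta <= b alpha on the plane: c (1 + \<mu> r) - k r is the first coordinate of the vector y + r u,
       whose length is a r *)
    have "(c * (1 + \<mu> * r) - k * r)\<^sup>2 + (k * (1 + \<mu> * r) + c * r)\<^sup>2 = (c\<^sup>2 + k\<^sup>2) * N r"
      unfolding N_def by algebra
    then have "(c * (1 + \<mu> * r) - k * r)\<^sup>2 \<le> (a r)\<^sup>2"
      unfolding a2 ck by (smt (verit) zero_le_power2)
    then have "\<bar>c * (1 + \<mu> * r) - k * r\<bar> \<le> a r"
      using a[of r] by (metis abs_le_square_iff abs_of_pos)
    then have "\<bar>L r\<bar> \<le> b * a r" unfolding L_def abs_mult using b by (simp add: mult_left_mono)
    then have "\<bar>\<sigma> r\<bar> \<le> b" unfolding \<sigma>_def using a[of r] by (simp add: divide_le_eq)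
    then show ?thesis using T(2) by (auto simp: abs_le_iff)
  qed
  have d\<phi>: "(\<phi> has_real_derivative deriv \<phi> x) (at x)"
    and d\<phi>': "(deriv \<phi> has_real_derivative deriv (deriv \<phi>) x) (at x)" if "x \<in> T" for x
    using smooth_on_has_real_derivative that T smooth_on_deriv by blast+
  have da: "(a has_real_derivative a' r) (at r)" for r
  proof -
    have "(N has_real_derivative 2 * (\<mu> * (1 + \<mu> * r) + r)) (at r)"
      unfolding N_def by (auto intro!: derivative_eq_intros simp: algebra_simps)
    then show ?thesis
      unfolding a_def a'_def using N[of r]
      by (auto intro!: derivative_eq_intros simp: field_simps)
  qed
  have dL: "(L has_real_derivative L') (at r)" for r
    unfolding L_def L'_def by (auto intro!: derivative_eq_intros simp: algebra_simps)
  have d\<sigma>: "(\<sigma> has_real_derivative \<sigma>' r) (at r)" for r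
  proof -
    have "((\<lambda>r. L r / a r) has_real_derivative (L' * a r - L r * a' r) / (a r * a r)) (at r)"
      by (rule DERIV_divide[OF dL da]) (use a[of r] in simp)
    moreover have "(L' * a r - L r * a' r) / (a r * a r) = \<sigma>' r"
      using a[of r] by (simp add: \<sigma>'_def \<sigma>_def field_simps)
    ultimately show ?thesis by (simp add: \<sigma>_def[abs_def])
  qed
  have dP: "(P has_real_derivative P' r) (at r)" for r
  proof -
    have "(P has_real_derivative a' r * \<phi> (\<sigma> r) + deriv \<phi> (\<sigma> r) * \<sigma>' r * a r) (at r)"
      unfolding P_def[abs_def] by (rule DERIV_mult[OF da DERIV_chain2[OF d\<phi>[OF \<sigma>T] d\<sigma>]])
    moreover have "a' r * \<phi> (\<sigma> r) + deriv \<phi> (\<sigma> r) * \<sigma>' r * a r = P' r"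
      using a[of r] by (simp add: P'_def h_def \<sigma>'_def field_simps)
    ultimately show ?thesis by simp
  qed
  have a0: "a 0 = 1" "a' 0 = \<mu>" "\<sigma> 0 = s" "\<sigma>' 0 = - b * k"
    by (simp_all add: a_def a'_def N_def \<sigma>_def L_def s_def \<sigma>'_def L'_def algebra_simps)
  have da': "(a' has_real_derivative 1) (at 0)"
  proof -
    have "((\<lambda>r. \<mu> * (1 + \<mu> * r) + r) has_real_derivative \<mu> * \<mu> + 1) (at 0)"
      by (auto intro!: derivative_eq_intros)
    from DERIV_divide[OF this da[of 0]] show ?thesis
      unfolding a'_def[abs_def] by (simp add: a0[unfolded a'_def] a0 algebra_simps)
  qed
  have dh: "(h has_real_derivative - x * deriv (deriv \<phi>) x) (at x)" if "x \<in> T" for x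
    unfolding h_def[abs_def]
    by (rule derivative_eq_intros d\<phi>[OF that] d\<phi>'[OF that] | simp)+
  let ?E = "\<phi> s - s * deriv \<phi> s + (b\<^sup>2 - s\<^sup>2) * deriv (deriv \<phi>) s"
  have dP': "(P' has_real_derivative ?E) (at 0)"
  proof -
    have "(P' has_real_derivative
        (1 * h (\<sigma> 0) + (- \<sigma> 0 * deriv (deriv \<phi>) (\<sigma> 0) * \<sigma>' 0) * a' 0)
        + L' * (deriv (deriv \<phi>) (\<sigma> 0) * \<sigma>' 0)) (at 0)"
      unfolding P'_def[abs_def]
      by (rule DERIV_add[OF DERIV_mult[OF da' DERIV_chain2[OF dh[OF \<sigma>T] d\<sigma>]]
            DERIV_cmult[OF DERIV_chain2[OF d\<phi>'[OF \<sigma>T] d\<sigma>]]])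
    moreover have "(1 * h (\<sigma> 0) + (- \<sigma> 0 * deriv (deriv \<phi>) (\<sigma> 0) * \<sigma>' 0) * a' 0)
        + L' * (deriv (deriv \<phi>) (\<sigma> 0) * \<sigma>' 0) = h s + b\<^sup>2 * k\<^sup>2 * deriv (deriv \<phi>) s"
      unfolding a0 L'_def by (simp add: s_def algebra_simps power2_eq_square)
    moreover have "b\<^sup>2 * k\<^sup>2 = b\<^sup>2 - s\<^sup>2"
    proof -
      have "k\<^sup>2 = 1 - c\<^sup>2" using ck by simp
      then show ?thesis by (simp only: s_def power_mult_distrib) (simp add: algebra_simps)
    qed
    ultimately show ?thesis by (simp add: h_def)
  qed
  have P0: "P 0 = \<phi> s" "P' 0 = \<mu> * \<phi> s - b * k * deriv \<phi> s"
    unfolding P_def P'_def a0 h_def L'_def by (simp_all add: s_def algebra_simps)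
  have "((\<lambda>r. (P r)\<^sup>2) has_real_derivative 2 * (P r * P' r)) (at r)" for r
    by (rule derivative_eq_intros dP | simp)+
  moreover have "((\<lambda>r. 2 * (P r * P' r)) has_real_derivative 2 * ((P' 0)\<^sup>2 + P 0 * ?E)) (at 0)"
    by (rule derivative_eq_intros dP dP' | simp add: power2_eq_square)+
  ultimately have "deriv (\<lambda>p. deriv (\<lambda>q. (P (p + q))\<^sup>2) 0) 0 = 2 * ((P' 0)\<^sup>2 + P 0 * ?E)"
    by (rule iterated_deriv_translate[where f = "\<lambda>r. (P r)\<^sup>2"])
  then show ?thesis
    unfolding P0 by (simp add: P_def \<sigma>_def a_def L_def)
qed

section \<open>Profile functions\<close>

text \<open>
  For \<open>h = \<phi> - s \<phi>'\<close> we have \<open>h' = - s \<phi>''\<close>. At a minimum of \<open>h\<close> on \<open>[-b, b]\<close> the term with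
  \<open>\<phi>''\<close> in the hypothesis vanishes: at an end point because of its factor, at an interior point
  \<open>m \<noteq> 0\<close> because \<open>h'(m) = 0\<close>. So \<open>h(m) > 0\<close> there, while \<open>h(0) = \<phi>(0)\<close>. This argument covers
  surfaces, where strong convexity gives no direct access to \<open>\<phi> - s \<phi>'\<close>.
\<close>

lemma tangent_intercept_pos:
  fixes \<phi> :: "real \<Rightarrow> real"
  assumes T: "open T" "{-b..b} \<subseteq> T" "smooth_on T \<phi>" and "0 \<le> b" and "0 < \<phi> 0"
    and E: "\<And>s. \<bar>s\<bar> \<le> b \<Longrightarrow> 0 < \<phi> s - s * deriv \<phi> s + (b\<^sup>2 - s\<^sup>2) * deriv (deriv \<phi>) s"
    and "\<bar>s\<bar> \<le> b"
  shows "0 < \<phi> s - s * deriv \<phi> s"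
proof -
  define h where "h x = \<phi> x - x * deriv \<phi> x" for x
  have dh: "(h has_real_derivative - x * deriv (deriv \<phi>) x) (at x)" if "x \<in> T" for x
    unfolding h_def[abs_def]
    by (rule derivative_eq_intros smooth_on_has_real_derivative[OF T(3) that]
        smooth_on_has_real_derivative[OF smooth_on_deriv[OF T(3,1)] that] | simp)+
  have "continuous_on {-b..b} h"
    using dh T(2) by (meson DERIV_continuous continuous_at_imp_continuous_on subsetD)
  then obtain m where m: "m \<in> {-b..b}" and min: "\<And>x. x \<in> {-b..b} \<Longrightarrow> h m \<le> h x"
    using continuous_attains_inf[of "{-b..b}" h] \<open>0 \<le> b\<close> by auto
  have Em: "0 < h m + (b\<^sup>2 - m\<^sup>2) * deriv (deriv \<phi>) m"
    using E[of m] m by (simp add: h_def abs_le_iff)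
  have "0 < h m"
  proof (cases "\<bar>m\<bar> = b")
    case True
    then have "b\<^sup>2 = m\<^sup>2" by (metis power2_abs)
    with Em show ?thesis by simp
  next
    case False
    with m have "\<bar>m\<bar> < b" by (auto simp: abs_if split: if_splits)
    have "- m * deriv (deriv \<phi>) m = 0"
    proof (rule DERIV_local_min)
      show "(h has_real_derivative - m * deriv (deriv \<phi>) m) (at m)" using dh m T(2) by blast
      show "0 < b - \<bar>m\<bar>" using \<open>\<bar>m\<bar> < b\<close> by simp
      show "\<forall>y. \<bar>m - y\<bar> < b - \<bar>m\<bar> \<longrightarrow> h m \<le> h y"
        using min by (auto simp: abs_if split: if_splits)
    qed
    then show ?thesis using Em \<open>0 < \<phi> 0\<close> by (auto simp: h_def)
  qed
  also have "h m \<le> h s" using min assms(7) by (simp add: abs_le_iff)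
  finally show ?thesis by (simp add: h_def)
qed

text \<open>
  The expression \<open>h(s) + (t\<^sup>2 - s\<^sup>2) \<phi>''(s)\<close> with \<open>h = \<phi> - s \<phi>'\<close> is affine in \<open>t\<^sup>2\<close>, so its positivity
  for all \<open>\<bar>s\<bar> \<le> t < b\<^sub>0\<close> follows from that at the two ends \<open>t = \<bar>s\<bar>\<close>, where it is \<open>h(s)\<close>, and
  \<open>t = b\<^sub>0\<close>. For \<open>b\<^sub>0 = b\<close> both hold on the compact interval \<open>[-b, b]\<close>, hence they persist for some
  \<open>b\<^sub>0 > b\<close>.
\<close>

lemma profile_extends:
  fixes \<phi> :: "real \<Rightarrow> real"
  assumes T: "open T" "{-b..b} \<subseteq> T" "smooth_on T \<phi>" and b: "0 \<le> b"
    and pos: "\<And>s. \<bar>s\<bar> \<le> b \<Longrightarrow> 0 < \<phi> s"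
    and E: "\<And>s. \<bar>s\<bar> \<le> b \<Longrightarrow> 0 < \<phi> s - s * deriv \<phi> s + (b\<^sup>2 - s\<^sup>2) * deriv (deriv \<phi>) s"
  obtains b\<^sub>0 where "b < b\<^sub>0" "{s. \<bar>s\<bar> < b\<^sub>0} \<subseteq> T" "\<And>s. \<bar>s\<bar> < b\<^sub>0 \<Longrightarrow> 0 < \<phi> s"
    "\<And>s t. \<bar>s\<bar> \<le> t \<Longrightarrow> t < b\<^sub>0 \<Longrightarrow>
       0 < \<phi> s - s * deriv \<phi> s + (t\<^sup>2 - s\<^sup>2) * deriv (deriv \<phi>) s"
proof -
  define h where "h x = \<phi> x - x * deriv \<phi> x" for x
  define G where "G s t = h s + (t\<^sup>2 - s\<^sup>2) * deriv (deriv \<phi>) s" for s t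
  note sm = T(3) smooth_on_deriv[OF T(3,1)] smooth_on_deriv[OF smooth_on_deriv[OF T(3,1)] T(1)]
  note cont = sm[THEN smooth_on_continuous]
  have hpos: "0 < h s" if "\<bar>s\<bar> \<le> b" for s
    using tangent_intercept_pos[OF T b pos[of 0] E that] b by (simp add: h_def)
  let ?m = "\<lambda>z. min (\<phi> (fst z)) (min (h (fst z)) (G (fst z) (snd z)))"
  define W where "W = {z \<in> T \<times> (UNIV :: real set). ?m z \<in> {0<..}}"
  have cfst: "continuous_on (T \<times> UNIV) (\<lambda>z. f (fst z))" if "continuous_on T f" for f :: "real \<Rightarrow> real"
    using that by (rule continuous_on_compose2) (auto intro: continuous_intros)
  have "continuous_on (T \<times> UNIV) ?m"
    unfolding G_def h_def by (intro continuous_intros cfst cont)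
  then have "open W" unfolding W_def vimage_def[symmetric]
    using continuous_open_preimage[of "T \<times> UNIV" ?m "{0<..}"] open_Times[OF T(1) open_UNIV]
    by (simp add: vimage_def Int_def)
  moreover have "{-b..b} \<times> {b} \<subseteq> W"
    using T(2) pos hpos E by (auto simp: W_def G_def h_def abs_le_iff)
  ultimately obtain \<epsilon> where \<epsilon>: "0 < \<epsilon>" "(\<Union>z\<in>{-b..b} \<times> {b}. ball z \<epsilon>) \<subseteq> W"
    using compact_subset_open_imp_ball_epsilon_subset[of "{-b..b} \<times> {b}" W]
    by (metis compact_Icc compact_Times compact_sing finite.emptyI)
  define b\<^sub>0 where "b\<^sub>0 = b + \<epsilon> / 3"
  have W: "(s, b\<^sub>0) \<in> W" if "\<bar>s\<bar> < b\<^sub>0" for s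
  proof -
    define s' where "s' = max (-b) (min b s)"
    have "\<bar>s' - s\<bar> \<le> \<epsilon> / 3" "s' \<in> {-b..b}" using that b \<epsilon>(1)
      by (auto simp: s'_def b\<^sub>0_def max_def min_def abs_if split: if_splits)
    moreover have "dist (s', b) (s, b\<^sub>0) \<le> \<bar>s' - s\<bar> + \<bar>b - b\<^sub>0\<bar>"
      by (simp add: dist_prod_def dist_real_def sqrt_sum_squares_le_sum_abs)
    ultimately have "(s, b\<^sub>0) \<in> ball (s', b) \<epsilon>" using \<epsilon>(1) by (simp add: b\<^sub>0_def)
    with \<epsilon>(2) \<open>s' \<in> {-b..b}\<close> show ?thesis by blast
  qed
  show thesis
  proof
    show "b < b\<^sub>0" using \<epsilon>(1) by (simp add: b\<^sub>0_def)
    show "{s. \<bar>s\<bar> < b\<^sub>0} \<subseteq> T" "\<And>s. \<bar>s\<bar> < b\<^sub>0 \<Longrightarrow> 0 < \<phi> s" using W by (auto simp: W_def)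
    fix s t :: real assume st: "\<bar>s\<bar> \<le> t" "t < b\<^sub>0"
    then have "0 < h s" "0 < G s b\<^sub>0" using W[of s] by (auto simp: W_def)
    have "s\<^sup>2 \<le> t\<^sup>2" using power_mono[OF st(1), of 2] by simp
    have "t\<^sup>2 \<le> b\<^sub>0\<^sup>2" using power_mono[of t b\<^sub>0 2] st by simp
    have "0 < h s + (t\<^sup>2 - s\<^sup>2) * deriv (deriv \<phi>) s"
    proof (cases "0 \<le> deriv (deriv \<phi>) s")
      case True
      with \<open>0 < h s\<close> \<open>s\<^sup>2 \<le> t\<^sup>2\<close> show ?thesis by (simp add: add_pos_nonneg)
    next
      case False
      then have "(b\<^sub>0\<^sup>2 - s\<^sup>2) * deriv (deriv \<phi>) s \<le> (t\<^sup>2 - s\<^sup>2) * deriv (deriv \<phi>) s"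
        using \<open>t\<^sup>2 \<le> b\<^sub>0\<^sup>2\<close> by (intro mult_right_mono_neg) auto
      with \<open>0 < G s b\<^sub>0\<close> show ?thesis by (simp add: G_def)
    qed
    then show "0 < \<phi> s - s * deriv \<phi> s + (t\<^sup>2 - s\<^sup>2) * deriv (deriv \<phi>) s"
      by (simp add: h_def)
  qed
qed

section \<open>The inner product on a tangent space\<close>

lemma tscale_0 [simp]: "tscale 0 v = tzero"
  by (simp add: tscale_def tzero_def)

text \<open>
  Tangent vectors at a point form a carrier inside a function type, with operations \<open>tadd\<close> and
  \<open>tscale\<close> outside the vector space classes; hence inner products on them are axiomatized here.
\<close>

locale tangent_inner_product =
  fixes T :: "('p, 'e::euclidean_space) tvec set"
    and ip :: "('p, 'e) tvec \<Rightarrow> ('p, 'e) tvec \<Rightarrow> real"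
  assumes tadd_closed: "v \<in> T \<Longrightarrow> w \<in> T \<Longrightarrow> tadd v w \<in> T"
    and tscale_closed: "v \<in> T \<Longrightarrow> tscale r v \<in> T"
    and ip_sym: "v \<in> T \<Longrightarrow> w \<in> T \<Longrightarrow> ip v w = ip w v"
    and ip_pos: "v \<in> T \<Longrightarrow> v \<noteq> tzero \<Longrightarrow> 0 < ip v v"
    and ip_tscale_left: "v \<in> T \<Longrightarrow> w \<in> T \<Longrightarrow> ip (tscale r v) w = r * ip v w"
    and ip_tadd_left: "v \<in> T \<Longrightarrow> w \<in> T \<Longrightarrow> z \<in> T \<Longrightarrow> ip (tadd v w) z = ip v z + ip w z"
begin

abbreviation comb :: "('p, 'e) tvec \<Rightarrow> ('p, 'e) tvec \<Rightarrow> real \<Rightarrow> real \<Rightarrow> ('p, 'e) tvec" where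
  "comb v w r s \<equiv> tadd (tscale r v) (tscale s w)"

lemma ip_tscale_right: "v \<in> T \<Longrightarrow> w \<in> T \<Longrightarrow> ip v (tscale r w) = r * ip v w"
  by (metis ip_sym ip_tscale_left tscale_closed)

lemma ip_tadd_right: "v \<in> T \<Longrightarrow> w \<in> T \<Longrightarrow> z \<in> T \<Longrightarrow> ip z (tadd v w) = ip z v + ip z w"
  by (metis ip_sym ip_tadd_left tadd_closed)

lemmas ip_bilinear = ip_tscale_left ip_tscale_right ip_tadd_left ip_tadd_right tadd_closed tscale_closed

lemma ip_tzero: "v \<in> T \<Longrightarrow> ip v tzero = 0" "v \<in> T \<Longrightarrow> ip tzero v = 0"
  using ip_tscale_left[of v v 0] ip_tscale_right[of v v 0] by simp_all

lemma ip_nonneg: "v \<in> T \<Longrightarrow> 0 \<le> ip v v"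
  using ip_pos ip_tzero by (metis less_eq_real_def)

lemma ip_Cauchy_Schwarz:
  assumes v: "v \<in> T" and w: "w \<in> T"
  shows "\<bar>ip v w\<bar> \<le> sqrt (ip v v) * sqrt (ip w w)"
proof (cases "w = tzero")
  case False
  define r where "r = ip v w / ip w w"
  have "0 < ip w w" using ip_pos w False by simp
  have "0 \<le> ip (comb v w 1 (- r)) (comb v w 1 (- r))"
    using v w by (intro ip_nonneg tadd_closed tscale_closed)
  also have "\<dots> = ip v v - 2 * r * ip v w + r\<^sup>2 * ip w w"
    using v w ip_sym[OF w v] by (simp add: ip_bilinear algebra_simps power2_eq_square)
  also have "\<dots> = ip v v - (ip v w)\<^sup>2 / ip w w"
    using \<open>0 < ip w w\<close> by (simp add: r_def power2_eq_square field_simps)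
  finally have "(ip v w)\<^sup>2 \<le> ip v v * ip w w"
    using \<open>0 < ip w w\<close> by (simp add: field_simps)
  then have "sqrt ((ip v w)\<^sup>2) \<le> sqrt (ip v v * ip w w)" by (rule real_sqrt_le_mono)
  then show ?thesis by (simp add: real_sqrt_mult)
qed (use v tscale_closed[OF v, of 0] in \<open>simp add: ip_tzero\<close>)

text \<open>
  The supremum is attained at \<open>X\<close>, or at any vector if \<open>X = 0\<close>. Hence \<open>\<parallel>\<beta>\<parallel> = \<alpha>(X)\<close>, a form in
  which its invariance is evident.
\<close>

lemma operator_norm_ip:
  assumes X: "X \<in> T" and "\<exists>y\<in>T. y \<noteq> tzero"
  shows "(SUP y\<in>T - {tzero}. \<bar>ip X y\<bar> / sqrt (ip y y)) = sqrt (ip X X)"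
proof (rule cSup_eq_maximum)
  show "x \<le> sqrt (ip X X)" if "x \<in> (\<lambda>y. \<bar>ip X y\<bar> / sqrt (ip y y)) ` (T - {tzero})" for x
  proof -
    obtain y where y: "y \<in> T" "y \<noteq> tzero" and x: "x = \<bar>ip X y\<bar> / sqrt (ip y y)"
      using \<open>x \<in> _\<close> by blast
    show ?thesis
      using ip_Cauchy_Schwarz[OF X y(1)] ip_pos[OF y] unfolding x by (simp add: divide_le_eq)
  qed
  show "sqrt (ip X X) \<in> (\<lambda>y. \<bar>ip X y\<bar> / sqrt (ip y y)) ` (T - {tzero})"
  proof (cases "X = tzero")
    case True
    obtain y where "y \<in> T - {tzero}" using assms(2) by blast
    moreover from this True have "sqrt (ip X X) = \<bar>ip X y\<bar> / sqrt (ip y y)"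
      using X by (simp add: ip_tzero)
    ultimately show ?thesis by blast
  next
    case False
    then have "sqrt (ip X X) = \<bar>ip X X\<bar> / sqrt (ip X X)"
      using ip_pos[OF X] by (simp add: real_div_sqrt)
    with False X show ?thesis by blast
  qed
qed

lemma orthonormal_pair:
  assumes X: "X \<in> T" "X \<noteq> tzero" and w: "w \<in> T" "\<And>r. w \<noteq> tscale r X"
  obtains e1 e2 where "e1 \<in> T" "e2 \<in> T" "ip e1 e1 = 1" "ip e2 e2 = 1" "ip e1 e2 = 0"
    "ip X e1 = sqrt (ip X X)" "ip X e2 = 0"
proof -
  define b where "b = sqrt (ip X X)"
  have b: "0 < b" "ip X X = b * b" using ip_pos[OF X] by (simp_all add: b_def)
  define r where "r = ip X w / ip X X"
  define n where "n = comb w X 1 (- r)"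
  have nT: "n \<in> T" using X w by (simp add: n_def tadd_closed tscale_closed)
  have "n \<noteq> tzero"
  proof
    assume "n = tzero"
    then have "n c = 0" for c by (simp add: tzero_def)
    then have "w c = tscale r X c" for c by (simp add: n_def tadd_def tscale_def)
    then have "w = tscale r X" by (rule ext)
    with w(2) show False by blast
  qed
  define a where "a = sqrt (ip n n)"
  have a: "0 < a" "ip n n = a * a" using ip_pos[OF nT \<open>n \<noteq> tzero\<close>] by (simp_all add: a_def)
  have Xn: "ip X n = 0"
    using X w b by (simp add: n_def ip_bilinear r_def)
  show thesis
  proof
    show "tscale (1 / b) X \<in> T" "tscale (1 / a) n \<in> T" using X nT by (simp_all add: tscale_closed)
    show "ip (tscale (1 / b) X) (tscale (1 / b) X) = 1" "ip (tscale (1 / a) n) (tscale (1 / a) n) = 1"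
      "ip (tscale (1 / b) X) (tscale (1 / a) n) = 0"
      "ip X (tscale (1 / b) X) = sqrt (ip X X)" "ip X (tscale (1 / a) n) = 0"
      using X nT a b Xn by (simp_all add: ip_bilinear)
  qed
qed

end

lemma tangent_inner_product_metric:
  assumes "smooth_manifold M" "riemannian_metric M g" "p \<in> points M"
  shows "tangent_inner_product (tangent_space M p) (g p)"
  using assms tangent_space_tadd[OF assms(1)] tangent_space_tscale[OF assms(1)]
  unfolding riemannian_metric_def by unfold_locales blast+

section \<open>Strong convexity of the profile at a point\<close>

text \<open>
  If \<open>F\<close> vanishes at \<open>y\<close>, then by homogeneity it vanishes on the ray through \<open>y\<close>, and the
  fundamental tensor at \<open>y\<close> vanishes in the direction \<open>y\<close>.
\<close>

lemma finsler_pos: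
  assumes M: "smooth_manifold M" and F: "finsler_metric M F" and p: "p \<in> points M"
    and y: "y \<in> tangent_space M p" "y \<noteq> tzero"
  shows "0 < F p y"
proof (rule ccontr)
  assume "\<not> 0 < F p y"
  then have "F p y = 0" using F p y unfolding finsler_metric_def by force
  have eq: "(F p (tadd y (tadd (tscale s y) (tscale t y))))\<^sup>2 = 0" if "-1/2 < s" "-1/2 < t" for s t
  proof -
    have "tadd y (tadd (tscale s y) (tscale t y)) = tscale (1 + s + t) y"
      by (simp add: tadd_def tscale_def algebra_simps)
    then have "F p (tadd y (tadd (tscale s y) (tscale t y))) = (1 + s + t) * F p y"
      using F p y that unfolding finsler_metric_def by simp
    with \<open>F p y = 0\<close> show ?thesis by simp
  qed
  have near: "\<forall>\<^sub>F s in nhds (0::real). -1/2 < s"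
    by (rule eventually_nhds_in_open[of "{-1/2<..}", simplified]) auto
  have "deriv (\<lambda>t. (F p (tadd y (tadd (tscale s y) (tscale t y))))\<^sup>2) 0 = deriv (\<lambda>t. 0) 0"
    if "-1/2 < s" for s
    by (rule deriv_cong_ev[OF eventually_mono[OF near]]) (use eq that in auto)
  then have "deriv (\<lambda>s. deriv (\<lambda>t. (F p (tadd y (tadd (tscale s y) (tscale t y))))\<^sup>2) 0) 0
      = deriv (\<lambda>s. 0) 0"
    by (intro deriv_cong_ev[OF eventually_mono[OF near]]) auto
  then have "fundamental_tensor F p y y y = 0" by (simp add: fundamental_tensor_def)
  moreover have "0 < fundamental_tensor F p y y y"
    using F p y unfolding finsler_metric_def by blast
  ultimately show False by simp
qed

text \<open>
  If \<open>X\<close> and \<open>w\<close> are linearly independent, every \<open>s \<in> [-b, b]\<close> is the value of \<open>\<beta>/\<alpha>\<close> at a unit vector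
  \<open>y\<close> of the plane that they span. There the fundamental tensor is evaluated in the direction \<open>u\<close> for
  which \<open>F\<close> has derivative 0 along \<open>y + r u\<close>, so that it reduces to \<open>F F''\<close>, which is
  \<open>\<phi>\<close> times the expression in question.
\<close>

lemma profile_convexity:
  assumes M: "smooth_manifold M" and F: "finsler_metric M F" and g: "riemannian_metric M g"
    and p: "p \<in> points M" and X: "X \<in> tangent_space M p" "X \<noteq> tzero"
    and w: "w \<in> tangent_space M p" "\<And>r. w \<noteq> tscale r X"
    and rep: "\<And>y. y \<in> tangent_space M p \<Longrightarrow> y \<noteq> tzero \<Longrightarrow>
      F p y = sqrt (g p y y) * \<phi> (g p X y / sqrt (g p y y))"
    and b: "b = sqrt (g p X X)"
    and T: "open T" "{-b..b} \<subseteq> T" "smooth_on T \<phi>" and s: "\<bar>s\<bar> \<le> b"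
  shows "0 < \<phi> s" "0 < \<phi> s - s * deriv \<phi> s + (b\<^sup>2 - s\<^sup>2) * deriv (deriv \<phi>) s"
proof -
  interpret tangent_inner_product "tangent_space M p" "g p"
    by (rule tangent_inner_product_metric[OF M g p])
  obtain e1 e2 where e: "e1 \<in> tangent_space M p" "e2 \<in> tangent_space M p"
    and on: "g p e1 e1 = 1" "g p e2 e2 = 1" "g p e1 e2 = 0" "g p X e1 = b" "g p X e2 = 0"
    using orthonormal_pair[OF X w] unfolding b by metis
  have on': "g p e2 e1 = 0" using on(3) ip_sym[OF e] by simp
  have "0 < b" using ip_pos[OF X] by (simp add: b)
  have comb_in: "comb e1 e2 x y \<in> tangent_space M p" for x y
    using e by (simp add: tadd_closed tscale_closed)
  have norm_comb: "g p (comb e1 e2 x y) (comb e1 e2 x y) = x\<^sup>2 + y\<^sup>2" for x y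
    using e on on' by (simp add: ip_bilinear power2_eq_square)
  have beta_comb: "g p X (comb e1 e2 x y) = b * x" for x y
    using e on X by (simp add: ip_bilinear)
  have comb_nz: "comb e1 e2 x y \<noteq> tzero" if "0 < x\<^sup>2 + y\<^sup>2" for x y
    using that norm_comb[of x y] ip_tzero(1)[OF comb_in[of x y]] by auto
  have F_comb: "F p (comb e1 e2 x y) = sqrt (x\<^sup>2 + y\<^sup>2) * \<phi> (b * x / sqrt (x\<^sup>2 + y\<^sup>2))"
    if "0 < x\<^sup>2 + y\<^sup>2" for x y
    using rep[OF comb_in comb_nz[OF that]] by (simp add: norm_comb beta_comb)
  define c where "c = s / b"
  define k where "k = sqrt (1 - c\<^sup>2)"
  have "c\<^sup>2 \<le> 1" using s \<open>0 < b\<close> by (simp add: c_def abs_square_le_1)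
  then have ck: "c\<^sup>2 + k\<^sup>2 = 1" by (simp add: k_def)
  have bc: "b * c = s" using \<open>0 < b\<close> by (simp add: c_def)
  show pos: "0 < \<phi> s"
    using finsler_pos[OF M F p comb_in comb_nz, of c k] F_comb[of c k] by (simp add: ck bc)
  (* the unit tangent of the circle, corrected by the multiple of y that kills the derivative of F *)
  define \<mu> where "\<mu> = b * k * deriv \<phi> s / \<phi> s"
  define N where "N r = (1 + \<mu> * r)\<^sup>2 + r\<^sup>2" for r
  have N: "0 < N r" for r
    unfolding N_def by (cases "r = 0") (auto intro: add_nonneg_pos)
  let ?y = "comb e1 e2 c k" and ?u = "comb e1 e2 (\<mu> * c - k) (\<mu> * k + c)"
  have "?u \<noteq> tzero"
  proof (rule comb_nz)
    have "(\<mu> * c - k)\<^sup>2 + (\<mu> * k + c)\<^sup>2 = (\<mu>\<^sup>2 + 1) * (c\<^sup>2 + k\<^sup>2)" by algebra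
    then show "0 < (\<mu> * c - k)\<^sup>2 + (\<mu> * k + c)\<^sup>2" unfolding ck
      by (simp add: add_nonneg_pos)
  qed
  then have "0 < fundamental_tensor F p ?y ?u ?u"
    using F p comb_in comb_nz[of c k] ck unfolding finsler_metric_def by simp
  moreover have "F p (tadd ?y (tadd (tscale q ?u) (tscale t ?u))) =
      sqrt (N (q + t)) * \<phi> (b * (c * (1 + \<mu> * (q + t)) - k * (q + t)) / sqrt (N (q + t)))" for q t
  proof -
    let ?x1 = "c * (1 + \<mu> * (q + t)) - k * (q + t)" and ?x2 = "k * (1 + \<mu> * (q + t)) + c * (q + t)"
    have "tadd ?y (tadd (tscale q ?u) (tscale t ?u)) = comb e1 e2 ?x1 ?x2"
      by (simp add: tadd_def tscale_def fun_eq_iff algebra_simps)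
    moreover have "?x1\<^sup>2 + ?x2\<^sup>2 = (c\<^sup>2 + k\<^sup>2) * N (q + t)" unfolding N_def by algebra
    ultimately show ?thesis using F_comb[of ?x1 ?x2] N by (simp add: ck)
  qed
  ultimately have "0 < (\<mu> * \<phi> s - b * k * deriv \<phi> s)\<^sup>2
      + \<phi> s * (\<phi> s - s * deriv \<phi> s + (b\<^sup>2 - s\<^sup>2) * deriv (deriv \<phi>) s)"
    using second_derivative_along_circle[OF T _ ck, of \<mu>] \<open>0 < b\<close>
    unfolding fundamental_tensor_def N_def bc by simp
  moreover have "\<mu> * \<phi> s - b * k * deriv \<phi> s = 0" using pos by (simp add: \<mu>_def)
  ultimately show "0 < \<phi> s - s * deriv \<phi> s + (b\<^sup>2 - s\<^sup>2) * deriv (deriv \<phi>) s"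
    using pos by (simp add: zero_less_mult_iff)
qed

section \<open>Profiles at a point and transitive actions\<close>

text \<open>
  If \<open>X = 0\<close> or the tangent space is the line through \<open>X\<close>, then \<open>\<beta>/\<alpha>\<close> takes the values \<open>\<plusminus>b\<close> only, and a
  Randers profile \<open>A + B s\<close> interpolates. Its convexity expression is the constant \<open>A\<close>. It is positive
  beyond \<open>[-b, b]\<close>, as it is positive at both ends.
\<close>

lemma affine_profile:
  fixes b c1 c2 :: real
  assumes "0 \<le> b" "0 < c1" "0 < c2" "b = 0 \<Longrightarrow> c1 = c2"
  obtains A B b\<^sub>0 where "0 < A" "b < b\<^sub>0" "A + B * b = c1" "A + B * (- b) = c2"
    "\<And>s. \<bar>s\<bar> < b\<^sub>0 \<Longrightarrow> 0 < A + B * s"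
proof -
  define A where "A = (c1 + c2) / 2"
  (* for b = 0 the division yields B = 0, which is the right slope since then c1 = c2 *)
  define B where "B = (c1 - c2) / (2 * b)"
  have AB: "2 * A = c1 + c2" "2 * (B * b) = c1 - c2"
    using assms(4) by (auto simp: A_def B_def)
  have "0 < A" using assms by (simp add: A_def)
  have "\<bar>B\<bar> * b = \<bar>B * b\<bar>" using assms(1) by (simp add: abs_mult)
  also have "\<dots> < A" using AB assms(2,3) by linarith
  finally have lt: "\<bar>B\<bar> * b < A" .
  define b\<^sub>0 where "b\<^sub>0 = (if B = 0 then b + 1 else A / \<bar>B\<bar>)"
  show thesis
  proof
    show "0 < A" by fact
    show "A + B * b = c1" "A + B * (- b) = c2" using AB by simp_all
    show "b < b\<^sub>0" using lt by (simp add: b\<^sub>0_def field_simps)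
    show "0 < A + B * s" if "\<bar>s\<bar> < b\<^sub>0" for s
    proof (cases "B = 0")
      case False
      then have "\<bar>B * s\<bar> < A" using that by (simp add: b\<^sub>0_def abs_mult field_simps)
      then show ?thesis by linarith
    qed (use \<open>0 < A\<close> in simp)
  qed
qed

text \<open>
  At a single point \<open>F\<close> has a one-variable profile, and strong convexity makes it satisfy the inequality in the definition of an \<open>(\<alpha>, \<beta>)\<close>-metric. The profile is
  the given one unless \<open>X = 0\<close> or \<open>X\<close> spans the tangent space; in these cases the given profile is
  constrained at \<open>\<plusminus>b\<close> only and is replaced by an affine one.
\<close>

lemma alpha_beta_profile_at_point:
  assumes M: "smooth_manifold M" and X: "vector_field M X"
    and F: "general_alpha_beta_metric_by M g X F" and p: "p \<in> points M"
    and b: "b = sqrt (g p (X p) (X p))"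
  obtains b\<^sub>0 \<phi> where "b < b\<^sub>0" "smooth_on {s. \<bar>s\<bar> < b\<^sub>0} \<phi>" "\<And>s. \<bar>s\<bar> < b\<^sub>0 \<Longrightarrow> 0 < \<phi> s"
    "\<And>s t. \<bar>s\<bar> \<le> t \<Longrightarrow> t < b\<^sub>0 \<Longrightarrow>
       0 < \<phi> s - s * deriv \<phi> s + (t\<^sup>2 - s\<^sup>2) * deriv (deriv \<phi>) s"
    "\<And>y. y \<in> tangent_space M p \<Longrightarrow> y \<noteq> tzero \<Longrightarrow>
       F p y = sqrt (g p y y) * \<phi> (g p (X p) y / sqrt (g p y y))"
proof -
  have fm: "finsler_metric M F" and g: "riemannian_metric M g"
    using F by (auto simp: general_alpha_beta_metric_def)
  interpret tangent_inner_product "tangent_space M p" "g p"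
    by (rule tangent_inner_product_metric[OF M g p])
  have Xp: "X p \<in> tangent_space M p" using X p by (simp add: vector_field_def)
  have ex: "\<exists>y\<in>tangent_space M p. y \<noteq> tzero" using tangent_space_nonzero[OF M p] by blast
  have conorm: "conorm M g (dual_form g X) p = b"
    using operator_norm_ip[OF Xp ex] by (simp add: conorm_def dual_form_def alpha_norm_def b)
  obtain D \<Phi> where D: "openin (mtop (prod_manifold M real_line)) D"
      "\<And>s. \<bar>s\<bar> \<le> b \<Longrightarrow> (p, s) \<in> D"
      "smooth_fun_on (atlas (prod_manifold M real_line)) D (\<lambda>(p, s). \<Phi> p s)"
    and rep: "\<And>y. y \<in> tangent_space M p \<Longrightarrow> y \<noteq> tzero \<Longrightarrow>
       F p y = sqrt (g p y y) * \<Phi> p (g p (X p) y / sqrt (g p y y))"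
    using F p conorm unfolding general_alpha_beta_metric_def dual_form_def alpha_norm_def by blast
  have "0 \<le> b" using ip_nonneg[OF Xp] by (simp add: b)
  define T where "T = {s. (p, s) \<in> D}"
  have T: "open T" "{-b..b} \<subseteq> T" "smooth_on T (\<Phi> p)"
    using smooth_on_fibre_profile[OF M p D(1,3)] D(2) by (auto simp: T_def)
  have pos: "0 < \<Phi> p (g p (X p) y / sqrt (g p y y))" if "y \<in> tangent_space M p" "y \<noteq> tzero" for y
    using finsler_pos[OF M fm p that] rep[OF that] ip_pos[OF that] by (simp add: zero_less_mult_iff)
  show thesis
  proof (cases "X p \<noteq> tzero \<and> (\<exists>w\<in>tangent_space M p. \<forall>r. w \<noteq> tscale r (X p))")
    case True
    then obtain w where w: "X p \<noteq> tzero" "w \<in> tangent_space M p" "\<And>r. w \<noteq> tscale r (X p)" by blast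
    note conv = profile_convexity[where X = "X p" and \<phi> = "\<Phi> p", OF M fm g p Xp w rep b T]
    show thesis
      by (rule profile_extends[OF T \<open>0 \<le> b\<close> conv]) (use that rep smooth_on_subset[OF T(3)] in blast)+
  next
    case False
    have ratio: "g p (X p) y / sqrt (g p y y) = b \<or> g p (X p) y / sqrt (g p y y) = - b"
      if y: "y \<in> tangent_space M p" "y \<noteq> tzero" for y
    proof (cases "X p = tzero")
      case True
      then show ?thesis using y(1) Xp by (simp add: b ip_tzero)
    next
      case nz: False
      with False y obtain r where r: "y = tscale r (X p)" by blast
      have "r \<noteq> 0" using y r by auto
      have "0 < b" using ip_pos[OF Xp nz] by (simp add: b)
      have "g p (X p) (X p) = b * b" using ip_nonneg[OF Xp] by (simp add: b)
      then have "g p (X p) y = r * (b * b)" "sqrt (g p y y) = \<bar>r\<bar> * b"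
        using Xp \<open>0 < b\<close> by (simp_all add: r ip_bilinear real_sqrt_mult flip: mult.assoc)
      then show ?thesis using \<open>r \<noteq> 0\<close> \<open>0 < b\<close> by (simp add: abs_if)
    qed
    have ex_ratio: "\<exists>y\<in>tangent_space M p. y \<noteq> tzero \<and> g p (X p) y / sqrt (g p y y) = x"
      if "x = b \<or> x = - b" for x
    proof (cases "X p = tzero")
      case True
      then show ?thesis using ex that ratio by (auto simp: b ip_tzero)
    next
      case nz: False
      have *: "g p (X p) (X p) / sqrt (g p (X p) (X p)) = b"
        using ip_pos[OF Xp nz] by (simp add: b real_div_sqrt)
      let ?Y = "tscale (- 1) (X p)"
      have "?Y \<noteq> tzero"
        using nz by (auto simp: tscale_def tzero_def fun_eq_iff)
      moreover have "g p (X p) ?Y / sqrt (g p ?Y ?Y) = - b" "?Y \<in> tangent_space M p"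
        using Xp * by (simp_all add: ip_bilinear)
      ultimately show ?thesis using that nz * Xp by metis
    qed
    have pos_b: "0 < \<Phi> p b" "0 < \<Phi> p (- b)"
      using ex_ratio[of b] ex_ratio[of "- b"] pos by metis+
    have "b = 0 \<Longrightarrow> \<Phi> p b = \<Phi> p (- b)" by simp
    from affine_profile[OF \<open>0 \<le> b\<close> pos_b this]
    obtain A B b\<^sub>0 where AB: "0 < A" "b < b\<^sub>0" "A + B * b = \<Phi> p b" "A + B * (- b) = \<Phi> p (- b)"
        "\<And>s. \<bar>s\<bar> < b\<^sub>0 \<Longrightarrow> 0 < A + B * s"
      by metis
    have d: "deriv (\<lambda>s. A + B * s) = (\<lambda>s. B)"
      by (intro ext DERIV_imp_deriv) (auto intro!: derivative_eq_intros)
    show thesis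
    proof (rule that[OF AB(2) smooth_on_affine AB(5)])
      show "0 < A + B * s - s * deriv (\<lambda>s. A + B * s) s
              + (t\<^sup>2 - s\<^sup>2) * deriv (deriv (\<lambda>s. A + B * s)) s" for s t :: real
        using AB(1) by (simp add: d)
      show "F p y = sqrt (g p y y) * (A + B * (g p (X p) y / sqrt (g p y y)))"
        if "y \<in> tangent_space M p" "y \<noteq> tzero" for y
        using ratio[OF that] rep[OF that] AB(3,4) by metis
    qed
  qed
qed

text \<open>
  The profile at \<open>p\<close> serves at every \<open>q\<close>: if \<open>\<tau> a\<close> maps \<open>q\<close> to \<open>p\<close>, its differential maps nonzero
  vectors to nonzero vectors and preserves \<open>F\<close>, \<open>\<alpha>\<close> and \<open>\<beta>\<close>, so the
  representation of \<open>F\<close> at \<open>p\<close> pulls back to \<open>q\<close>.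
\<close>

lemma transitive_invariant_imp_alpha_beta:
  fixes \<tau> :: "'a \<Rightarrow> 'p \<Rightarrow> 'p" and M :: "('p, 'e::euclidean_space) manifold"
  assumes M: "smooth_manifold M" and p: "p \<in> points M"
    and trans: "\<And>q. q \<in> points M \<Longrightarrow> \<exists>a\<in>carrier G. \<tau> a q = p"
    and ginv: "invariant_riemannian G \<tau> M g"
    and X: "vector_field M X" and Xinv: "invariant_vector_field G \<tau> M X"
    and F: "general_alpha_beta_metric_by M g X F" and Finv: "invariant_finsler G \<tau> M F"
  shows "alpha_beta_metric_by M g X F"
proof -
  have fm: "finsler_metric M F" and g: "riemannian_metric M g" and \<beta>: "one_form M (dual_form g X)"
    using F by (auto simp: general_alpha_beta_metric_def)
  define b where "b = sqrt (g p (X p) (X p))"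
  obtain b\<^sub>0 \<phi> where \<phi>: "b < b\<^sub>0" "smooth_on {s. \<bar>s\<bar> < b\<^sub>0} \<phi>" "\<And>s. \<bar>s\<bar> < b\<^sub>0 \<Longrightarrow> 0 < \<phi> s"
      "\<And>s t. \<bar>s\<bar> \<le> t \<Longrightarrow> t < b\<^sub>0 \<Longrightarrow>
         0 < \<phi> s - s * deriv \<phi> s + (t\<^sup>2 - s\<^sup>2) * deriv (deriv \<phi>) s"
    and rep: "\<And>y. y \<in> tangent_space M p \<Longrightarrow> y \<noteq> tzero \<Longrightarrow>
         F p y = sqrt (g p y y) * \<phi> (g p (X p) y / sqrt (g p y y))"
    by (rule alpha_beta_profile_at_point[OF M X F p b_def]) (rule that)
  have XT: "X q \<in> tangent_space M q" if "q \<in> points M" for q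
    using X that by (simp add: vector_field_def)
  have "0 \<le> b"
    using tangent_inner_product.ip_nonneg[OF tangent_inner_product_metric[OF M g p] XT[OF p]]
    by (simp add: b_def)
  have at_q: "g q (X q) (X q) = g p (X p) (X p) \<and>
      (\<forall>y\<in>tangent_space M q - {tzero}.
         F q y = sqrt (g q y y) * \<phi> (g q (X q) y / sqrt (g q y y)))" if q: "q \<in> points M" for q
  proof -
    obtain a where a: "a \<in> carrier G" "\<tau> a q = p" using trans[OF q] by blast
    define d where "d = differential M M (\<tau> a) q"
    have iso: "isometry M g (\<tau> a)" using ginv a by (simp add: invariant_riemannian_def)
    then have dg: "g p (d v) (d w) = g q v w"
      if "v \<in> tangent_space M q" "w \<in> tangent_space M q" for v w
      using q that unfolding isometry_def d_def a(2)[symmetric] by blast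
    have dT: "d v \<in> tangent_space M p" for v
      using differential_in_tangent_space[OF M M, of "\<tau> a" q v] iso q a
      by (simp add: isometry_def diffeomorphism_def d_def)
    have dX: "d (X q) = X p"
      using Xinv a q by (auto simp: invariant_vector_field_def d_def)
    have dF: "F p (d y) = F q y" if "y \<in> tangent_space M q" for y
      using Finv a q that by (auto simp: invariant_finsler_def d_def)
    interpret q: tangent_inner_product "tangent_space M q" "g q"
      by (rule tangent_inner_product_metric[OF M g q])
    interpret p: tangent_inner_product "tangent_space M p" "g p"
      by (rule tangent_inner_product_metric[OF M g p])
    have "F q y = sqrt (g q y y) * \<phi> (g q (X q) y / sqrt (g q y y))"
      if y: "y \<in> tangent_space M q" "y \<noteq> tzero" for y
    proof -
      have "d y \<noteq> tzero"
        using q.ip_pos[OF y] dg[OF y(1) y(1)] p.ip_tzero(1)[OF dT[of y]] by auto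
      from rep[OF dT this] show ?thesis
        using dg[OF y(1) y(1)] dg[OF XT[OF q] y(1)] dF[OF y(1)] by (simp add: dX)
    qed
    moreover have "g q (X q) (X q) = g p (X p) (X p)"
      using dg[OF XT[OF q] XT[OF q]] by (simp add: dX)
    ultimately show ?thesis by blast
  qed
  have conorm: "conorm M g (dual_form g X) q = b" if q: "q \<in> points M" for q
    using tangent_inner_product.operator_norm_ip[OF tangent_inner_product_metric[OF M g q] XT[OF q]]
      tangent_space_nonzero[OF M q] at_q[OF q]
    by (auto simp: conorm_def dual_form_def alpha_norm_def b_def)
  show ?thesis
    unfolding alpha_beta_metric_def
    by (intro conjI fm g \<beta> exI[of _ "ereal b\<^sub>0"] exI[of _ \<phi>])
      (use \<phi> \<open>0 \<le> b\<close> conorm at_q in \<open>auto simp: dual_form_def alpha_norm_def\<close>)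
qed

theorem proposition3p1:
  fixes G :: "('a, 'r) monoid_scheme"
    and GM :: "('a, 'e::euclidean_space) manifold"
  shows "(\<forall>(H :: 'a set) (M :: ('a set, 'f::euclidean_space) manifold) g X F.
            homogeneous_space G GM H M \<and>
            riemannian_metric M g \<and> invariant_riemannian G (coset_translation G) M g \<and>
            vector_field M X \<and> invariant_vector_field G (coset_translation G) M X \<and>
            general_alpha_beta_metric_by M g X F \<longrightarrow>
            (invariant_finsler G (coset_translation G) M F \<and> general_alpha_beta_metric_by M g X F \<longleftrightarrow>
             invariant_finsler G (coset_translation G) M F \<and> alpha_beta_metric_by M g X F)) \<and>
         (\<forall>g X F.
            lie_group G GM \<and>
            riemannian_metric GM g \<and> invariant_riemannian G (left_translation G) GM g \<and>
            vector_field GM X \<and> invariant_vector_field G (left_translation G) GM X \<and>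
            general_alpha_beta_metric_by GM g X F \<and> invariant_finsler G (left_translation G) GM F \<longrightarrow>
            invariant_finsler G (left_translation G) GM F \<and> alpha_beta_metric_by GM g X F)"
proof -
  have homogeneous: "alpha_beta_metric_by M g X F"
    if hs: "homogeneous_space G GM H M"
      and inv: "invariant_riemannian G (coset_translation G) M g" "vector_field M X"
        "invariant_vector_field G (coset_translation G) M X" "general_alpha_beta_metric_by M g X F"
        "invariant_finsler G (coset_translation G) M F"
    for H :: "'a set" and M :: "('a set, 'f) manifold" and g X F
  proof -
    have M: "smooth_manifold M" and pts: "points M = lcosets\<^bsub>G\<^esub> H" and sub: "subgroup H G"
      using hs by (auto simp: homogeneous_space_def)
    interpret group G using hs by (simp add: homogeneous_space_def lie_group_def)
    have HG: "H \<subseteq> carrier G" using sub by (rule subgroup.subset)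
    have H: "\<one>\<^bsub>G\<^esub> <#\<^bsub>G\<^esub> H = H" using HG by (rule lcos_mult_one)
    have "H \<in> points M" unfolding pts LCOSETS_def using H by blast
    moreover have "\<exists>a\<in>carrier G. coset_translation G a q = H" if "q \<in> points M" for q
    proof -
      obtain x where x: "x \<in> carrier G" "q = x <#\<^bsub>G\<^esub> H"
        using \<open>q \<in> points M\<close> unfolding pts LCOSETS_def by blast
      then have "coset_translation G (inv\<^bsub>G\<^esub> x) q = H"
        using lcos_m_assoc[OF HG, of "inv\<^bsub>G\<^esub> x" x] H by (simp add: coset_translation_def)
      with x show ?thesis by blast
    qed
    ultimately show ?thesis
      using transitive_invariant_imp_alpha_beta[OF M _ _ inv] by blast
  qed
  have lie: "alpha_beta_metric_by GM g X F"
    if lg: "lie_group G GM"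
      and inv: "invariant_riemannian G (left_translation G) GM g" "vector_field GM X"
        "invariant_vector_field G (left_translation G) GM X" "general_alpha_beta_metric_by GM g X F"
        "invariant_finsler G (left_translation G) GM F"
    for g X F
  proof -
    have M: "smooth_manifold GM" and pts: "points GM = carrier G"
      using lg by (auto simp: lie_group_def)
    interpret group G using lg by (simp add: lie_group_def)
    have "\<exists>a\<in>carrier G. left_translation G a q = \<one>\<^bsub>G\<^esub>" if "q \<in> points GM" for q
      using that unfolding pts left_translation_def by (metis inv_closed l_inv)
    moreover have "\<one>\<^bsub>G\<^esub> \<in> points GM" by (simp add: pts)
    ultimately show ?thesis
      using transitive_invariant_imp_alpha_beta[OF M _ _ inv] by blast
  qed
  show ?thesis using homogeneous lie by blast
qed

end
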